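(* Almost all cographs have a cospectral mate. That is, if $c_n$ denotes the number of isomorphism classes of cographs on $n$ vertices and $d_n$ the number of those isomorphism classes of cographs $G$ on $n$ vertices for which there exists a graph $H$ (not necessarily a cograph) with $H\not\cong G$ and $\mathrm{Spec}(H)=\mathrm{Spec}(G)$, then $d_n/c_n\to 1$ as $n\to\infty$.
   Context: A cograph is a finite simple graph obtained from the single-vertex graph by repeatedly applying disjoint union of two cographs and complementation (equivalently, a graph with no induced path on 4 vertices). For a graph $G$ with adjacency matrix $A$, $\mathrm{Spec}(G)$ is the multiset of eigenvalues of $A$. A cospectral mate of $G$ is a graph $H$ not isomorphic to $G$ with $\mathrm{Spec}(H)=\mathrm{Spec}(G)$. *)

theory Defs
  imports Complex_Main "HOL-Computational_Algebra.Polynomial" "Jordan_Normal_Form.Matrix"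
    "Jordan_Normal_Form.Char_Poly"
begin

definition all_edges :: "nat set \<Rightarrow> nat set set" where
  "all_edges V = {e. e \<subseteq> V \<and> card e = 2}"

inductive cograph :: "nat set \<Rightarrow> nat set set \<Rightarrow> bool" where
  single: "cograph {v} {}"
| union: "\<lbrakk>cograph V1 E1; cograph V2 E2; V1 \<inter> V2 = {}\<rbrakk> \<Longrightarrow> cograph (V1 \<union> V2) (E1 \<union> E2)"
| compl: "cograph V E \<Longrightarrow> cograph V (all_edges V - E)"

definition graphs :: "nat \<Rightarrow> nat set set set" where
  "graphs n = Pow (all_edges {0..<n})"

definition graph_iso :: "nat \<Rightarrow> nat set set \<Rightarrow> nat set set \<Rightarrow> bool" where
  "graph_iso n E E' \<longleftrightarrow> (\<exists>f. bij_betw f {0..<n} {0..<n} \<and> E' = (\<lambda>e. f ` e) ` E)"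

definition iso_class :: "nat \<Rightarrow> nat set set \<Rightarrow> nat set set set" where
  "iso_class n E = {E' \<in> graphs n. graph_iso n E E'}"

definition adj_matrix :: "nat \<Rightarrow> nat set set \<Rightarrow> complex mat" where
  "adj_matrix n E = mat n n (\<lambda>(i, j). if {i, j} \<in> E then 1 else 0)"

definition Spec :: "nat \<Rightarrow> nat set set \<Rightarrow> complex multiset" where
  "Spec n E = proots (char_poly (adj_matrix n E))"

definition has_cospectral_mate :: "nat \<Rightarrow> nat set set \<Rightarrow> bool" where
  "has_cospectral_mate n E \<longleftrightarrow>
     (\<exists>H \<in> graphs n. \<not> graph_iso n E H \<and> Spec n H = Spec n E)"

definition cograph_count :: "nat \<Rightarrow> nat" where
  "cograph_count n = card {iso_class n E | E. E \<in> graphs n \<and> cograph {0..<n} E}"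

definition cograph_mate_count :: "nat \<Rightarrow> nat" where
  "cograph_mate_count n = card {iso_class n E | E. E \<in> graphs n \<and> cograph {0..<n} E
                                   \<and> has_cospectral_mate n E}"

end

(*
  A cograph is, up to isomorphism, a multiset of cotrees: a disjoint union of connected cographs,
  each of them a vertex or the complement of a smaller multiset. Two particular cotrees (limbs) with
  15 leaves have the same two-variable characteristic polynomial det(xI - A - tJ), J the all-ones
  matrix. That polynomial behaves well under disjoint union and complement, so a cograph containing
  the first limb gets a non-isomorphic cospectral cograph by exchanging the limb for the second.

  It remains that cographs avoiding a given limb L are exponentially rare. The generating functions T
  of cotrees and F of multisets of cotrees satisfy F = 1 - x + 2T and F = exp(sum of -ln(1 - x^|t|)),
  which force F <= 2 at the radius of convergence rho. For cotrees avoiding L the corresponding F is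
  strictly less than 2 at rho, and then the fixed point equation keeps a finite solution at some
  point beyond rho. Joining two cotrees under a new root shows that the number of all cotrees times
  r^n tends to infinity for every r > rho, whence the ratio tends to 0.
*)

theory Submission
  imports Defs "HOL-Analysis.Uniform_Limit"
begin

unbundle no vec_syntax
hide_const (open) Finite_Cartesian_Product.mat Finite_Cartesian_Product.vec
hide_type (open) Finite_Cartesian_Product.vec

section \<open>Generating function of multisets\<close>

text \<open>The spectrum alone is not inherited under complementation, because the spectrum of a
  complement also depends on how the all-ones vector sits relative to the eigenspaces. The variable
  t records just this: complementing substitutes \<open>-1 - x\<close> and \<open>-1 - t\<close> up
  to sign, so an equality of two-variable polynomials survives all the way up to the root. That the
  exchange changes the isomorphism class rests on the uniqueness of the cotree. The number 2 is the
  critical value of the functional equation. Write F = exp (T + h), with h the part of the exponent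
  of order at least two, so that 2 T = x - 1 + exp (T + h). The derivatives of the two sides in T
  are 2 and F, so the solution can be continued as long as F < 2. There is room to continue because
  h is controlled by the series at x^2 and hence stays finite and continuous somewhat beyond rho.
  Partial sums and a monotone iteration take the place of complex analysis, and a mere exponential
  gap that of asymptotic formulas.\<close>

lemma bounded_multisets_insert:
  assumes "a \<notin> S"
  shows "bij_betw (\<lambda>(j, M). M + replicate_mset j a)
     ({..J} \<times> {M. set_mset M \<subseteq> S \<and> (\<forall>b. count M b \<le> J)})
     {M. set_mset M \<subseteq> insert a S \<and> (\<forall>b. count M b \<le> J)}"
proof (rule bij_betw_byWitness[where f' = "\<lambda>M. (count M a, filter_mset (\<lambda>b. b \<noteq> a) M)"])
  show "\<forall>p\<in>{..J} \<times> {M. set_mset M \<subseteq> S \<and> (\<forall>b. count M b \<le> J)}.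
      (\<lambda>M. (count M a, filter_mset (\<lambda>b. b \<noteq> a) M)) (case p of (j, M) \<Rightarrow> M + replicate_mset j a) = p"
  proof
    fix p assume p: "p \<in> {..J} \<times> {M. set_mset M \<subseteq> S \<and> (\<forall>b. count M b \<le> J)}"
    then obtain j M where [simp]: "p = (j, M)" and "set_mset M \<subseteq> S" by auto
    then have "a \<notin># M" using assms by auto
    then have "count M a = 0" by (simp add: not_in_iff)
    then show "(\<lambda>M. (count M a, filter_mset (\<lambda>b. b \<noteq> a) M)) (case p of (j, M) \<Rightarrow> M + replicate_mset j a) = p"
      by (auto intro!: multiset_eqI)
  qed
  show "\<forall>M\<in>{M. set_mset M \<subseteq> insert a S \<and> (\<forall>b. count M b \<le> J)}.
     (case (count M a, filter_mset (\<lambda>b. b \<noteq> a) M) of (j, M) \<Rightarrow> M + replicate_mset j a) = M"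
    by (auto intro!: multiset_eqI)
  show "(\<lambda>(j, M). M + replicate_mset j a) `
    ({..J} \<times> {M. set_mset M \<subseteq> S \<and> (\<forall>b. count M b \<le> J)})
    \<subseteq> {M. set_mset M \<subseteq> insert a S \<and> (\<forall>b. count M b \<le> J)}"
  proof
    fix N assume "N \<in> (\<lambda>(j, M). M + replicate_mset j a) `
      ({..J} \<times> {M. set_mset M \<subseteq> S \<and> (\<forall>b. count M b \<le> J)})"
    then obtain j M where *: "N = M + replicate_mset j a" "j \<le> J" "set_mset M \<subseteq> S" "\<forall>b. count M b \<le> J"
      by auto
    have "count M a = 0" using * assms by (metis not_in_iff subsetD)
    then have "count N b \<le> J" for b using * by auto
    moreover have "set_mset N \<subseteq> insert a S" using * by (auto split: if_splits)
    ultimately show "N \<in> {M. set_mset M \<subseteq> insert a S \<and> (\<forall>b. count M b \<le> J)}" by blast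
  qed
  show "(\<lambda>M. (count M a, filter_mset (\<lambda>b. b \<noteq> a) M)) `
    {M. set_mset M \<subseteq> insert a S \<and> (\<forall>b. count M b \<le> J)}
    \<subseteq> {..J} \<times> {M. set_mset M \<subseteq> S \<and> (\<forall>b. count M b \<le> J)}"
    by auto
qed

text \<open>Choosing a bounded multiset means choosing one exponent per element, so expanding the
  product yields each multiset once. The bound \<open>J\<close> keeps everything finite, hence
  purely algebraic.\<close>

lemma sum_bounded_multisets:
  fixes f :: "'a \<Rightarrow> 'b::comm_semiring_1"
  assumes "finite S"
  shows "finite {M. set_mset M \<subseteq> S \<and> (\<forall>b. count M b \<le> J)} \<and>
    (\<Sum>M | set_mset M \<subseteq> S \<and> (\<forall>b. count M b \<le> J). \<Prod>a\<in>#M. f a) = (\<Prod>a\<in>S. \<Sum>j\<le>J. f a ^ j)"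
  using assms
proof (induction S rule: finite_induct)
  case empty
  have "{M::'a multiset. set_mset M \<subseteq> {} \<and> (\<forall>b. count M b \<le> J)} = {{#}}" by auto
  then show ?case by simp
next
  case (insert a S)
  let ?B = "\<lambda>S. {M. set_mset M \<subseteq> S \<and> (\<forall>b. count M b \<le> J)}"
  note bij = bounded_multisets_insert[OF insert(2), of J]
  have "finite ({..J} \<times> ?B S)" using insert by auto
  then have fin: "finite (?B (insert a S))" using bij_betw_finite[OF bij] by blast
  have "(\<Sum>M\<in>?B (insert a S). \<Prod>a\<in>#M. f a)
      = (\<Sum>(j, M)\<in>{..J} \<times> ?B S. \<Prod>b\<in>#M + replicate_mset j a. f b)"
    by (subst sum.reindex_bij_betw[OF bij, symmetric]) (simp add: case_prod_unfold)
  also have "\<dots> = (\<Sum>(j, M)\<in>{..J} \<times> ?B S. f a ^ j * (\<Prod>b\<in>#M. f b))"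
    by (intro sum.cong refl) (auto simp: mult.commute)
  also have "\<dots> = (\<Sum>j\<le>J. f a ^ j) * (\<Sum>M\<in>?B S. \<Prod>b\<in>#M. f b)"
    by (simp add: sum_product sum.cartesian_product)
  finally show ?case using insert fin by simp
qed

lemma neg_ln_one_minus_bounds:
  fixes y :: real assumes "0 \<le> y" "y \<le> c" "c < 1"
  shows "0 \<le> - ln (1 - y)" "y \<le> - ln (1 - y)" "- ln (1 - y) \<le> y / (1 - c)"
proof -
  have "- ln (1 - y) = ln (1 / (1 - y))" using assms by (simp add: ln_div)
  also have "\<dots> \<le> 1 / (1 - y) - 1" using assms by (intro ln_le_minus_one) auto
  also have "\<dots> = y / (1 - y)" using assms by (simp add: field_simps)
  also have "\<dots> \<le> y / (1 - c)" using assms by (intro divide_left_mono) auto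
  finally show "- ln (1 - y) \<le> y / (1 - c)" .
  show "y \<le> - ln (1 - y)" using ln_le_minus_one[of "1 - y"] assms by auto
  then show "0 \<le> - ln (1 - y)" using assms by linarith
qed

lemma summable_on_neg_ln:
  fixes f :: "'a \<Rightarrow> real"
  assumes "f summable_on S" "\<And>a. a \<in> S \<Longrightarrow> 0 \<le> f a" "\<And>a. a \<in> S \<Longrightarrow> f a \<le> c" "c < 1"
  shows "(\<lambda>a. - ln (1 - f a)) summable_on S"
proof (rule summable_on_comparison_test)
  show "(\<lambda>a. f a / (1 - c)) summable_on S"
    using summable_on_cmult_left[OF assms(1), of "1 / (1 - c)"] by simp
qed (use neg_ln_one_minus_bounds[OF assms(2,3,4)] in auto)

text \<open>A finite family has bounded multiplicities, so its sum is part of an expanded product of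
  truncated geometric series, each at most \<open>1 / (1 - f a)\<close>.\<close>

lemma sum_multisets_le:
  fixes f :: "'a \<Rightarrow> real"
  assumes fin: "finite \<M>" "finite S" and sub: "\<And>M. M \<in> \<M> \<Longrightarrow> set_mset M \<subseteq> S"
    and f: "\<And>a. a \<in> S \<Longrightarrow> 0 \<le> f a" "\<And>a. a \<in> S \<Longrightarrow> f a < 1"
  shows "(\<Sum>M\<in>\<M>. \<Prod>a\<in>#M. f a) \<le> exp (\<Sum>a\<in>S. - ln (1 - f a))"
proof -
  \<comment> \<open>Sizes bound multiplicities; the inserted 0 keeps \<open>Max\<close> meaningful
    for an empty family.\<close>
  define J where "J = Max (insert 0 (size ` \<M>))"
  have J: "count M b \<le> J" if "M \<in> \<M>" for M b
    unfolding J_def using that fin count_le_size[of M b] by (auto intro: order_trans Max_ge)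
  have nn: "0 \<le> (\<Prod>a\<in>#M. f a)" if "set_mset M \<subseteq> S" for M
    using that f(1) by (induction M) auto
  have "(\<Sum>M\<in>\<M>. \<Prod>a\<in>#M. f a) \<le> (\<Sum>M | set_mset M \<subseteq> S \<and> (\<forall>b. count M b \<le> J). \<Prod>a\<in>#M. f a)"
    using sum_bounded_multisets[OF fin(2), where f = f] sub J nn by (intro sum_mono2) auto
  also have "\<dots> = (\<Prod>a\<in>S. \<Sum>j\<le>J. f a ^ j)"
    using sum_bounded_multisets[OF fin(2), where f = f] by auto
  also have "\<dots> \<le> (\<Prod>a\<in>S. exp (- ln (1 - f a)))"
  proof (intro prod_mono conjI)
    fix a assume a: "a \<in> S"
    show "0 \<le> (\<Sum>j\<le>J. f a ^ j)" using f a by (auto intro: sum_nonneg)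
    have "(\<Sum>j\<le>J. f a ^ j) = (1 - f a ^ Suc J) / (1 - f a)"
      using f[OF a] by (subst sum_gp0) auto
    also have "\<dots> \<le> 1 / (1 - f a)" using f[OF a] by (intro divide_right_mono) auto
    finally show "(\<Sum>j\<le>J. f a ^ j) \<le> exp (- ln (1 - f a))" using f[OF a]
      by (simp add: exp_minus inverse_eq_divide)
  qed
  also have "\<dots> = exp (\<Sum>a\<in>S. - ln (1 - f a))" using fin by (simp add: exp_sum)
  finally show ?thesis .
qed

text \<open>An Euler product in logarithmic form. The uniform bound \<open>c < 1\<close> makes the
  logarithms summable; the lower bound comes from letting \<open>J\<close> tend to infinity for each
  finite part of \<open>S\<close>.\<close>

lemma has_sum_multisets:
  fixes f :: "'a \<Rightarrow> real"
  assumes summ: "f summable_on S" and nn: "\<And>a. a \<in> S \<Longrightarrow> 0 \<le> f a"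
    and le: "\<And>a. a \<in> S \<Longrightarrow> f a \<le> c" "c < 1"
  shows "((\<lambda>M. \<Prod>a\<in>#M. f a) has_sum exp (\<Sum>\<^sub>\<infinity>a\<in>S. - ln (1 - f a))) {M. set_mset M \<subseteq> S}"
proof -
  let ?l = "\<lambda>a. - ln (1 - f a)" and ?F = "{M. set_mset M \<subseteq> S}" and ?P = "\<lambda>M. \<Prod>a\<in>#M. f a"
  have lt: "f a < 1" if "a \<in> S" for a using le that by force
  have l0: "0 \<le> ?l a" if "a \<in> S" for a using neg_ln_one_minus_bounds(1)[OF nn le] that by auto
  have sl: "?l summable_on S" using assms by (rule summable_on_neg_ln)
  have P0: "0 \<le> ?P M" if "M \<in> ?F" for M
    using that nn by (induction M) auto
  have up: "sum ?P \<M> \<le> exp (infsum ?l S)" if "finite \<M>" "\<M> \<subseteq> ?F" for \<M>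
  proof -
    let ?S = "\<Union>(set_mset ` \<M>)"
    have S: "finite ?S" "?S \<subseteq> S" using that by auto
    have "sum ?P \<M> \<le> exp (sum ?l ?S)" using that S nn lt
      by (intro sum_multisets_le) auto
    also have "\<dots> \<le> exp (infsum ?l S)"
      using finite_sum_le_infsum[OF sl S] l0 by auto
    finally show ?thesis .
  qed
  have sP: "?P summable_on ?F"
    using P0 up by (intro nonneg_bdd_above_summable_on) (auto intro!: bdd_aboveI)
  have "infsum ?P ?F \<le> exp (infsum ?l S)" using sP up by (rule infsum_le_finite_sums)
  moreover have "exp (infsum ?l S) \<le> infsum ?P ?F"
  proof -
    have fin: "exp (sum ?l S0) \<le> infsum ?P ?F" if S0: "finite S0" "S0 \<subseteq> S" for S0
    proof (rule LIMSEQ_le_const2)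
      have "(\<lambda>J. \<Sum>j\<le>J. f a ^ j) \<longlonglongrightarrow> exp (?l a)" if "a \<in> S0" for a
      proof -
        have "a \<in> S" using that S0 by auto
        then have "(\<lambda>j. f a ^ j) sums (1 / (1 - f a))"
          using nn lt by (intro geometric_sums) auto
        moreover have "exp (?l a) = 1 / (1 - f a)"
          using lt[OF \<open>a \<in> S\<close>] by (simp add: exp_minus inverse_eq_divide)
        ultimately show ?thesis by (simp add: sums_def_le)
      qed
      then have "(\<lambda>J. \<Prod>a\<in>S0. \<Sum>j\<le>J. f a ^ j) \<longlonglongrightarrow> (\<Prod>a\<in>S0. exp (?l a))"
        by (intro tendsto_prod) auto
      then show "(\<lambda>J. \<Prod>a\<in>S0. \<Sum>j\<le>J. f a ^ j) \<longlonglongrightarrow> exp (sum ?l S0)"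
        using S0 by (simp only: exp_sum)
      show "\<exists>N. \<forall>J\<ge>N. (\<Prod>a\<in>S0. \<Sum>j\<le>J. f a ^ j) \<le> infsum ?P ?F"
      proof (intro exI allI impI)
        fix J
        let ?B = "{M. set_mset M \<subseteq> S0 \<and> (\<forall>b. count M b \<le> J)}"
        have "(\<Prod>a\<in>S0. \<Sum>j\<le>J. f a ^ j) = sum ?P ?B" "finite ?B"
          using sum_bounded_multisets[OF S0(1), where f = f] by auto
        then show "(\<Prod>a\<in>S0. \<Sum>j\<le>J. f a ^ j) \<le> infsum ?P ?F"
          using finite_sum_le_infsum[OF sP, of ?B] P0 S0 by auto
      qed
    qed
    \<comment> \<open>The empty product shows that the sum is at least 1, so its logarithm may be
      taken.\<close>
    have pos: "0 < infsum ?P ?F" using fin[of "{}"] by simp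
    have "infsum ?l S \<le> ln (infsum ?P ?F)"
      using fin pos by (intro infsum_le_finite_sums[OF sl]) (simp add: ln_ge_iff)
    then show ?thesis using pos by (simp add: ln_ge_iff)
  qed
  ultimately show ?thesis using sP by (metis antisym has_sum_infsum)
qed

section \<open>Cotrees\<close>

datatype cotree = Leaf | Node "cotree multiset"

primrec leaves :: "cotree \<Rightarrow> nat" where
  "leaves Leaf = 1"
| "leaves (Node M) = sum_mset (image_mset leaves M)"

text \<open>The parameter collects forbidden limbs: \<open>cotrees {}\<close> are all cotrees, \<open>cotrees {L}\<close> those
  without a subtree \<open>L\<close>. A node has at least two children, so the datatype contains junk.\<close>

inductive_set cotrees :: "cotree set \<Rightarrow> cotree set" for X where
  Leaf: "Leaf \<notin> X \<Longrightarrow> Leaf \<in> cotrees X"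
| Node: "(\<And>t. t \<in># M \<Longrightarrow> t \<in> cotrees X) \<Longrightarrow> 2 \<le> size M \<Longrightarrow> Node M \<notin> X \<Longrightarrow> Node M \<in> cotrees X"

definition cforests :: "cotree set \<Rightarrow> cotree multiset set" where
  "cforests X = {M. set_mset M \<subseteq> cotrees X}"

definition cforests2 :: "cotree set \<Rightarrow> cotree multiset set" where
  "cforests2 X = {M \<in> cforests X. 2 \<le> size M}"

definition cotrees_le :: "cotree set \<Rightarrow> nat \<Rightarrow> cotree set" where
  "cotrees_le X m = {t \<in> cotrees X. leaves t \<le> m}"

lemma leaves_pos: "t \<in> cotrees X \<Longrightarrow> 1 \<le> leaves t"
proof (induction rule: cotrees.induct)
  case (Node M)
  then obtain t N where "M = add_mset t N" by (metis multi_nonempty_split size_empty not_numeral_le_zero)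
  then show ?case using Node.IH[of t] by simp
qed simp

lemma size_le_leaves: "M \<in> cforests X \<Longrightarrow> size M \<le> leaves (Node M)"
proof (induction M)
  case (add t M)
  then show ?case using leaves_pos[of t X] by (auto simp: cforests_def)
qed simp

text \<open>A second child contributes at least one more leaf. This strict decrease supports every
  recursion on the number of leaves.\<close>

lemma leaves_child_less:
  assumes "M \<in> cforests2 X" "t \<in># M"
  shows "leaves t < leaves (Node M)"
proof -
  obtain N where N: "M = add_mset t N" using multi_member_split[OF assms(2)] by blast
  then have "1 \<le> size N" "N \<in> cforests X" using assms by (auto simp: cforests2_def cforests_def)
  then show ?thesis using size_le_leaves[of N X] N by simp
qed

lemma leaves_child_le: "t \<in># M \<Longrightarrow> leaves t \<le> leaves (Node M)"
  using multi_member_split[of t M] by auto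

text \<open>The right side is what the construction would give without the last exclusion; the trees
  it adds are the forbidden ones all of whose children avoid \<open>X\<close>. Adding them back
  turns the inductive definition into a set equation that can be summed.\<close>

lemma cotrees_Un:
  assumes "Leaf \<notin> X"
  shows "cotrees X \<union> (X \<inter> Node ` cforests2 X) = insert Leaf (Node ` cforests2 X)"
proof -
  have "t \<in> insert Leaf (Node ` cforests2 X)" if "t \<in> cotrees X" for t
    using that by cases (auto simp: cforests_def cforests2_def)
  moreover have "t \<in> cotrees X" if "t \<in> insert Leaf (Node ` cforests2 X)" "t \<notin> X" for t
    using that by (auto simp: cforests_def cforests2_def intro: cotrees.intros)
  ultimately show ?thesis using assms by blast
qed

lemma cotrees_disjoint: "cotrees X \<inter> X = {}"
  by (auto elim: cotrees.cases)

lemma finite_cforests_aux: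
  assumes "finite (cotrees_le X m)"
  shows "finite {M. set_mset M \<subseteq> cotrees_le X m \<and> size M \<le> n}"
proof -
  have "{M. set_mset M \<subseteq> cotrees_le X m \<and> size M \<le> n} \<subseteq> (\<Union>k\<le>n. multisets_of_size (cotrees_le X m) k)"
    by (auto simp: multisets_of_size_def)
  moreover have "finite (\<Union>k\<le>n. multisets_of_size (cotrees_le X m) k)" using assms by auto
  ultimately show ?thesis by (rule finite_subset)
qed

lemma finite_cotrees_le: "finite (cotrees_le X m)"
proof (induction m)
  case 0
  have "cotrees_le X 0 = {}" unfolding cotrees_le_def using leaves_pos by fastforce
  then show ?case by simp
next
  case (Suc m)
  have "cotrees_le X (Suc m) \<subseteq> insert Leaf (Node ` {M. set_mset M \<subseteq> cotrees_le X m \<and> size M \<le> Suc m})"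
  proof
    fix t assume t: "t \<in> cotrees_le X (Suc m)"
    then have "t \<in> cotrees X" "leaves t \<le> Suc m" by (auto simp: cotrees_le_def)
    then show "t \<in> insert Leaf (Node ` {M. set_mset M \<subseteq> cotrees_le X m \<and> size M \<le> Suc m})"
    proof cases
      case (Node M)
      then have M: "M \<in> cforests2 X" by (auto simp: cforests2_def cforests_def)
      have "set_mset M \<subseteq> cotrees_le X m"
        using leaves_child_less[OF M] \<open>leaves t \<le> Suc m\<close> Node by (fastforce simp: cotrees_le_def)
      moreover have "size M \<le> Suc m"
        using size_le_leaves[of M X] M \<open>leaves t \<le> Suc m\<close> Node by (auto simp: cforests2_def)
      ultimately show ?thesis using Node by auto
    qed simp
  qed
  then show ?case using finite_cforests_aux[OF Suc] by (auto intro: finite_subset)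
qed

lemma finite_cforests: "finite {M \<in> cforests X. leaves (Node M) \<le> m}"
proof (rule finite_subset)
  show "{M \<in> cforests X. leaves (Node M) \<le> m} \<subseteq> {M. set_mset M \<subseteq> cotrees_le X m \<and> size M \<le> m}"
  proof clarify
    fix M assume M: "M \<in> cforests X" "leaves (Node M) \<le> m"
    have "t \<in> cotrees_le X m" if "t \<in># M" for t
      using leaves_child_le[OF that] M that by (auto simp: cotrees_le_def cforests_def)
    then show "set_mset M \<subseteq> cotrees_le X m \<and> size M \<le> m"
      using size_le_leaves[OF M(1)] M(2) by auto
  qed
  show "finite {M. set_mset M \<subseteq> cotrees_le X m \<and> size M \<le> m}"
    by (rule finite_cforests_aux[OF finite_cotrees_le])
qed

lemma power_leaves_Node:
  fixes x :: real
  shows "x ^ leaves (Node M) = (\<Prod>t\<in>#M. x ^ leaves t)"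
  by (induction M) (auto simp: power_add)

lemma power_leaves_le:
  fixes x :: real
  assumes "0 \<le> x" "x < 1" "t \<in> cotrees X"
  shows "0 \<le> x ^ leaves t" "x ^ leaves t \<le> x" "x ^ leaves t < 1"
proof -
  show "x ^ leaves t \<le> x" using power_decreasing[of 1 "leaves t" x] leaves_pos[OF assms(3)] assms by simp
  then show "x ^ leaves t < 1" using assms by linarith
qed (use assms in auto)

text \<open>Roots have at least two children, so forests with no tree or one tree are split off.
  They account for the terms 1 and T in T = x + (F - 1 - T).\<close>

lemma cforests_decomp:
  "insert {#} ((\<lambda>t. {#t#}) ` cotrees X) \<union> cforests2 X = cforests X"
  "insert {#} ((\<lambda>t. {#t#}) ` cotrees X) \<inter> cforests2 X = {}"
proof -
  have "M \<in> insert {#} ((\<lambda>t. {#t#}) ` cotrees X) \<union> cforests2 X" if "M \<in> cforests X" for M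
  proof (cases "size M \<ge> 2")
    case False
    then consider "size M = 0" | "size M = 1" by linarith
    then show ?thesis
    proof cases
      case 2
      then obtain t where "M = {#t#}" using size_1_singleton_mset by blast
      then show ?thesis using that by (auto simp: cforests_def)
    qed simp
  qed (use that in \<open>auto simp: cforests2_def\<close>)
  then show "insert {#} ((\<lambda>t. {#t#}) ` cotrees X) \<union> cforests2 X = cforests X"
    by (auto simp: cforests_def cforests2_def)
qed (auto simp: cforests2_def)

text \<open>A finite version of the functional equation that presupposes no convergence: children of
  a tree with at most m + 1 leaves have at most m leaves. Iterating it is how convergence gets
  proved, both near 0 and beyond \<open>rho\<close>.\<close>

lemma sum_cotrees_le_Suc:
  fixes x :: real
  assumes x: "0 \<le> x" "x < 1" and "Leaf \<notin> X"
  shows "(\<Sum>t\<in>cotrees_le X (Suc m). x ^ leaves t) +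
      (\<Sum>t\<in>X \<inter> Node ` {M \<in> cforests2 X. leaves (Node M) \<le> Suc m}. x ^ leaves t)
    \<le> x + (exp (\<Sum>t\<in>cotrees_le X m. - ln (1 - x ^ leaves t)) - 1 - (\<Sum>t\<in>cotrees_le X m. x ^ leaves t))"
proof -
  let ?N = "{M \<in> cforests2 X. leaves (Node M) \<le> Suc m}" and ?f = "\<lambda>t. x ^ leaves t"
  have finN: "finite ?N" by (rule finite_subset[OF _ finite_cforests[of X "Suc m"]]) (auto simp: cforests2_def)
  have Un: "cotrees_le X (Suc m) \<union> (X \<inter> Node ` ?N) = insert Leaf (Node ` ?N)"
  proof (intro Set.set_eqI)
    fix t
    show "(t \<in> cotrees_le X (Suc m) \<union> (X \<inter> Node ` ?N)) = (t \<in> insert Leaf (Node ` ?N))"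
      using eqset_imp_iff[OF cotrees_Un[OF assms(3)], of t] unfolding cotrees_le_def
      by (cases "leaves t \<le> Suc m") auto
  qed
  have "sum ?f (cotrees_le X (Suc m)) + sum ?f (X \<inter> Node ` ?N)
    = sum ?f (cotrees_le X (Suc m) \<union> (X \<inter> Node ` ?N))"
    using finN finite_cotrees_le cotrees_disjoint[of X]
      by (intro sum.union_disjoint[symmetric]) (auto simp: cotrees_le_def)
  also have "\<dots> = x + sum ?f (Node ` ?N)"
    unfolding Un using finN by (subst sum.insert) auto
  also have "sum ?f (Node ` ?N) = (\<Sum>M\<in>?N. x ^ leaves (Node M))"
    by (subst sum.reindex) (auto simp: inj_on_def)
  finally have 1: "sum ?f (cotrees_le X (Suc m)) + sum ?f (X \<inter> Node ` ?N) = x + (\<Sum>M\<in>?N. x ^ leaves (Node M))" .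
  let ?A = "insert {#} ((\<lambda>t. {#t#}) ` cotrees_le X m)"
  have "1 + sum ?f (cotrees_le X m) + (\<Sum>M\<in>?N. x ^ leaves (Node M))
    = (\<Sum>M\<in>?A. x ^ leaves (Node M)) + (\<Sum>M\<in>?N. x ^ leaves (Node M))"
    using finite_cotrees_le[of X m] by (subst sum.insert) (auto simp: sum.reindex inj_on_def)
  also have "\<dots> = (\<Sum>M\<in>?A \<union> ?N. x ^ leaves (Node M))"
    using finite_cotrees_le[of X m] finN cforests_decomp(2)[of X]
    by (intro sum.union_disjoint[symmetric]) (auto simp: cotrees_le_def)
  also have "\<dots> = (\<Sum>M\<in>?A \<union> ?N. \<Prod>t\<in>#M. x ^ leaves t)" by (simp only: power_leaves_Node)
  also have "\<dots> \<le> exp (\<Sum>t\<in>cotrees_le X m. - ln (1 - x ^ leaves t))"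
  proof (rule sum_multisets_le)
    fix M assume "M \<in> ?A \<union> ?N"
    then show "set_mset M \<subseteq> cotrees_le X m"
    proof
      assume "M \<in> ?N"
      then show ?thesis using leaves_child_less[of M X]
        by (fastforce simp: cotrees_le_def cforests2_def cforests_def)
    qed auto
  qed (use finN finite_cotrees_le power_leaves_le[OF x] x in \<open>auto simp: cotrees_le_def\<close>)
  finally show ?thesis using 1 by linarith
qed

text \<open>Where the series converges this is the generating function of \<open>cforests X\<close>,
  by \<open>has_sum_cforests\<close>. The exponential form suits multiplicative comparison of two
  arguments.\<close>

definition forest_gf :: "cotree set \<Rightarrow> real \<Rightarrow> real" where
  "forest_gf X x = exp (\<Sum>\<^sub>\<infinity>t\<in>cotrees X. - ln (1 - x ^ leaves t))"

definition cotree_sum :: "cotree set \<Rightarrow> real \<Rightarrow> real" where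
  "cotree_sum X x = (\<Sum>\<^sub>\<infinity>t\<in>cotrees X. x ^ leaves t)"

lemma has_sum_cforests:
  fixes x :: real
  assumes x: "0 \<le> x" "x < 1" and "(\<lambda>t. x ^ leaves t) summable_on cotrees X"
  shows "((\<lambda>M. x ^ leaves (Node M)) has_sum forest_gf X x) (cforests X)"
  unfolding power_leaves_Node forest_gf_def cforests_def
  using assms power_leaves_le[OF x] by (intro has_sum_multisets[where c = x]) auto

text \<open>Both sides sum \<open>cotrees_Un\<close>, with F - 1 - T counting the forests of at
  least two trees. For \<open>X = {}\<close> this reads F = 1 - x + 2 T.\<close>

lemma cotree_sum_eq:
  fixes x :: real
  assumes x: "0 \<le> x" "x < 1" and summ: "(\<lambda>t. x ^ leaves t) summable_on cotrees X" and X: "Leaf \<notin> X" "finite X"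
  shows "cotree_sum X x + (\<Sum>t\<in>X \<inter> Node ` cforests2 X. x ^ leaves t) = x + (forest_gf X x - 1 - cotree_sum X x)"
proof -
  let ?f = "\<lambda>t. x ^ leaves t" and ?g = "\<lambda>M. x ^ leaves (Node M)"
  let ?A = "insert {#} ((\<lambda>t. {#t#}) ` cotrees X)"
  have t: "(?f has_sum cotree_sum X x) (cotrees X)" using summ by (simp add: cotree_sum_def)
  have "(?g has_sum cotree_sum X x) ((\<lambda>t. {#t#}) ` cotrees X)"
    using t by (subst has_sum_reindex) (auto simp: inj_on_def o_def)
  then have "(?g has_sum 1 + cotree_sum X x) ({{#}} \<union> (\<lambda>t. {#t#}) ` cotrees X)"
    by (intro has_sum_Un_disjoint) (use has_sum_finite[of "{{#}}" ?g] in auto)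
  then have "(?g has_sum 1 + cotree_sum X x) ?A" by simp
  moreover have "?A \<subseteq> cforests X" using cforests_decomp(1)[of X] by blast
  ultimately have "(?g has_sum forest_gf X x - (1 + cotree_sum X x)) (cforests X - ?A)"
    by (rule has_sum_Diff[OF has_sum_cforests[OF x summ]])
  also have "cforests X - ?A = cforests2 X" 
  proof -
    have "C - A = B" if "A \<union> B = C" "A \<inter> B = {}" for A B C :: "cotree multiset set" using that by blast
    then show ?thesis using cforests_decomp .
  qed
  finally have "(?f has_sum forest_gf X x - (1 + cotree_sum X x)) (Node ` cforests2 X)"
    by (subst has_sum_reindex) (auto simp: inj_on_def o_def)
  then have "(?f has_sum x + (forest_gf X x - (1 + cotree_sum X x))) ({Leaf} \<union> Node ` cforests2 X)"
    by (intro has_sum_Un_disjoint) (use has_sum_finite[of "{Leaf}" ?f] in auto)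
  then have 1: "(?f has_sum x + (forest_gf X x - (1 + cotree_sum X x))) (cotrees X \<union> (X \<inter> Node ` cforests2 X))"
    using cotrees_Un[OF X(1)] by simp
  have "(?f has_sum cotree_sum X x + (\<Sum>t\<in>X \<inter> Node ` cforests2 X. ?f t)) (cotrees X \<union> (X \<inter> Node ` cforests2 X))"
    using cotrees_disjoint[of X] X(2) t by (intro has_sum_Un_disjoint has_sum_finite) auto
  then show ?thesis using has_sum_unique[OF _ 1] by force
qed

section \<open>The radius of convergence\<close>

definition converges :: "cotree set \<Rightarrow> real \<Rightarrow> bool" where
  "converges X x \<longleftrightarrow> 0 < x \<and> x < 1 \<and> (\<lambda>t. x ^ leaves t) summable_on cotrees X"

lemma convergesD: "converges X x \<Longrightarrow> 0 < x" "converges X x \<Longrightarrow> 0 \<le> x" "converges X x \<Longrightarrow> x < 1"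
  "converges X x \<Longrightarrow> (\<lambda>t. x ^ leaves t) summable_on cotrees X"
  by (auto simp: converges_def)

lemma cotrees_antimono: "X \<subseteq> Y \<Longrightarrow> cotrees Y \<subseteq> cotrees X"
proof
  fix t assume "X \<subseteq> Y" "t \<in> cotrees Y"
  from this(2,1) show "t \<in> cotrees X" by induction (auto intro: cotrees.intros)
qed

lemma converges_mono:
  assumes y: "converges X y" and x: "0 < x" "x \<le> y" and "X \<subseteq> Y"
  shows "converges Y x"
proof -
  have "(\<lambda>t. y ^ leaves t) summable_on cotrees Y"
    using convergesD(4)[OF y] cotrees_antimono[OF \<open>X \<subseteq> Y\<close>] by (rule summable_on_subset_banach)
  then have "(\<lambda>t. x ^ leaves t) summable_on cotrees Y"
    by (rule summable_on_comparison_test) (use x in \<open>auto intro: power_mono\<close>)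
  then show ?thesis using x convergesD(3)[OF y] by (simp add: converges_def)
qed

lemma finite_subset_cotrees_le:
  assumes "finite S" "S \<subseteq> cotrees X"
  shows "\<exists>m. S \<subseteq> cotrees_le X m"
proof (intro exI subsetI)
  fix t assume "t \<in> S"
  then show "t \<in> cotrees_le X (Max (leaves ` S))" using assms by (auto simp: cotrees_le_def)
qed

text \<open>Partial sums increase with m, so a bound from some index on suffices. The start
  \<open>k\<close> serves the limb-avoiding iteration, which is controlled only from the size of the
  limb on.\<close>

lemma converges_bounded:
  assumes x: "0 < x" "x < 1" and bd: "\<And>m. m \<ge> k \<Longrightarrow> (\<Sum>t\<in>cotrees_le X m. x ^ leaves t) \<le> u"
  shows "converges X x"
  unfolding converges_def
proof (intro conjI x nonneg_bdd_above_summable_on bdd_aboveI)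
  fix s assume "s \<in> sum (\<lambda>t. x ^ leaves t) ` {F. F \<subseteq> cotrees X \<and> finite F}"
  then obtain S where S: "S \<subseteq> cotrees X" "finite S" "s = (\<Sum>t\<in>S. x ^ leaves t)" by auto
  obtain m where "S \<subseteq> cotrees_le X m" using finite_subset_cotrees_le S by blast
  then have "S \<subseteq> cotrees_le X (max k m)" by (auto simp: cotrees_le_def)
  then have "s \<le> (\<Sum>t\<in>cotrees_le X (max k m). x ^ leaves t)"
    unfolding S(3) using finite_cotrees_le x by (intro sum_mono2) auto
  then show "s \<le> u" using bd[of "max k m"] by simp
qed (use x in auto)

text \<open>This makes \<open>rho\<close> positive. If a partial sum s is at most 1/5, the next one
  is at most 1/10 + s/9 + 20 s/81, again below 1/5.\<close>

lemma converges_tenth: "converges {} (1/10)"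
proof (rule converges_bounded)
  fix m
  let ?s = "\<lambda>m. \<Sum>t\<in>cotrees_le {} m. (1/10::real) ^ leaves t"
  show "?s m \<le> 1/5"
  proof (induction m)
    case 0
    have "cotrees_le {} 0 = {}" unfolding cotrees_le_def using leaves_pos by fastforce
    then show ?case by simp
  next
    case (Suc m)
    let ?l = "\<Sum>t\<in>cotrees_le {} m. - ln (1 - (1/10::real) ^ leaves t)"
    have s0: "0 \<le> ?s m" by (intro sum_nonneg) auto
    have "?l \<le> (\<Sum>t\<in>cotrees_le {} m. (1/10) ^ leaves t / (1 - 1/10))"
      using power_leaves_le[of "1/10" _ "{}"]
      by (intro sum_mono neg_ln_one_minus_bounds(3)) (auto simp: cotrees_le_def)
    also have "\<dots> = 10/9 * ?s m" unfolding sum_distrib_left by (intro sum.cong) auto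
    finally have "exp ?l \<le> exp (10/9 * ?s m)" by simp
    also have "\<dots> \<le> 1 + 10/9 * ?s m + (10/9 * ?s m)\<^sup>2" using s0 Suc by (intro exp_bound) auto
    also have "(10/9 * ?s m)\<^sup>2 \<le> 100/81 * (1/5 * ?s m)"
      using mult_right_mono[OF Suc s0] by (simp add: power2_eq_square)
    finally have "exp ?l \<le> 1 + 10/9 * ?s m + 100/81 * (1/5 * ?s m)" by simp
    moreover have "?s (Suc m) \<le> 1/10 + (exp ?l - 1 - ?s m)"
      using sum_cotrees_le_Suc[of "1/10" "{}" m] by simp
    ultimately show ?case using Suc s0 by linarith
  qed
qed auto

lemma cotree_sum_ge:
  assumes "converges X x" "finite S" "S \<subseteq> cotrees X"
  shows "(\<Sum>t\<in>S. x ^ leaves t) \<le> cotree_sum X x"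
  unfolding cotree_sum_def using assms convergesD[OF assms(1)] by (intro finite_sum_le_infsum) auto

lemma forest_gf_cotree_sum: "converges {} x \<Longrightarrow> forest_gf {} x = 1 - x + 2 * cotree_sum {} x"
  using cotree_sum_eq[of x "{}"] convergesD[of "{}" x] by simp

text \<open>From \<open>F(y) \<ge> F(x) (1 + D)\<close> and \<open>F(y) - F(x) = 2 D - (y - x)\<close> with \<open>D = T(y) - T(x)\<close>, the value
  \<open>F(x) \<ge> 2\<close> is impossible. This replaces the usual argument with the derivative of \<open>T\<close>.\<close>

lemma forest_gf_less_2:
  assumes x: "0 < x" "x < y" and y: "converges {} y"
  shows "forest_gf {} x < 2"
proof (rule ccontr)
  assume "\<not> forest_gf {} x < 2"
  then have z2: "forest_gf {} x \<ge> 2" by simp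
  have cx: "converges {} x" using converges_mono[OF y] x by auto
  define D where "D = cotree_sum {} y - cotree_sum {} x"
  let ?l = "\<lambda>x t. - ln (1 - x ^ leaves t)"
  have sl: "?l z summable_on cotrees {}" if "converges {} z" for z
    using convergesD[OF that] power_leaves_le[of z _ "{}"] by (intro summable_on_neg_ln[where c = z]) auto
  have pw: "y ^ leaves t - x ^ leaves t \<le> ?l y t - ?l x t \<and> 0
    \<le> y ^ leaves t - x ^ leaves t" if "t \<in> cotrees {}" for t
  proof -
    define a b where "a = x ^ leaves t" and "b = y ^ leaves t"
    have ab: "0 \<le> a" "a \<le> b" "b < 1"
      using power_leaves_le[OF convergesD(2,3)[OF y] that] x unfolding a_def b_def by (auto intro: power_mono)
    \<comment> \<open>The function -ln (1 - y) has slope at least 1 on [0, 1); here this follows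
      from ln z \<le> z - 1.\<close>
    have "ln ((1 - b) / (1 - a)) \<le> (1 - b) / (1 - a) - 1" using ab by (intro ln_le_minus_one) auto
    also have "\<dots> = - ((b - a) / (1 - a))" using ab by (simp add: field_simps)
    finally have "ln ((1 - b) / (1 - a)) \<le> - ((b - a) / (1 - a))" .
    moreover have "(b - a) / (1 - a) \<ge> b - a" using ab by (simp add: le_divide_eq mult_left_le)
    moreover have "ln ((1 - b) / (1 - a)) = ln (1 - b) - ln (1 - a)" using ab by (simp add: ln_div)
    ultimately show ?thesis using ab unfolding a_def b_def by simp
  qed
  have diff: "((\<lambda>t. f t - g t) has_sum (infsum f A - infsum g A)) A"
    if "f summable_on A" "g summable_on A" for f g :: "cotree \<Rightarrow> real" and A
    using has_sum_add[OF has_sum_infsum has_sum_uminusI[OF has_sum_infsum], OF that] by simp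
  have s1: "((\<lambda>t. y ^ leaves t - x ^ leaves t) has_sum D) (cotrees {})"
    unfolding D_def cotree_sum_def using convergesD(4)[OF y] convergesD(4)[OF cx]
    by (intro diff)
  have s2: "((\<lambda>t. ?l y t - ?l x t) has_sum (infsum (?l y) (cotrees {}) - infsum (?l x) (cotrees {}))) (cotrees {})"
    using sl[OF y] sl[OF cx] by (intro diff)
  have "D \<le> infsum (?l y) (cotrees {}) - infsum (?l x) (cotrees {})"
    using pw by (intro has_sum_mono[OF s1 s2]) auto
  have D0: "0 \<le> D" using pw has_sum_nonneg[OF s1] by auto
  have "forest_gf {} x * (1 + D) \<le> forest_gf {} x * exp D"
    using z2 by (intro mult_left_mono exp_ge_add_one_self) auto
  also have "\<dots> \<le> forest_gf {} y"
    using \<open>D \<le> _\<close> unfolding forest_gf_def by (simp flip: exp_add)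
  finally have "forest_gf {} x * (1 + D) \<le> forest_gf {} y" .
  then have "forest_gf {} x * D \<le> forest_gf {} y - forest_gf {} x" by (simp add: algebra_simps)
  also have "\<dots> = 2 * D - (y - x)" using forest_gf_cotree_sum[OF y] forest_gf_cotree_sum[OF cx]
    by (simp add: D_def)
  also have "\<dots> < 2 * D" using x by simp
  finally show False using mult_right_mono[OF z2 D0] by simp
qed

definition rho :: real where "rho = Sup {x. converges {} x}"

text \<open>Keeps \<open>rho\<close> strictly below 1, so that \<open>sqrt rho\<close> exceeds it.
  At 2/3 the cotrees with one and two leaves already give T \<ge> 10/9 and hence F \<ge> 23/9 >
  2.\<close>

lemma converges_imp_le_two_thirds:
  assumes "converges {} x" shows "x \<le> 2/3"
proof (rule ccontr)
  assume "\<not> x \<le> 2/3"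
  then have x: "2/3 < x" by simp
  have c: "converges {} (2/3)" using converges_mono[OF assms] x by auto
  let ?t = "Node {#Leaf, Leaf#}"
  have "?t \<in> cotrees {}" by (rule cotrees.Node) (auto intro: cotrees.Leaf)
  then have "(\<Sum>t\<in>{Leaf, ?t}. (2/3) ^ leaves t) \<le> cotree_sum {} (2/3)"
    using c by (intro cotree_sum_ge) (auto intro: cotrees.Leaf)
  then have "2/3 + 4/9 \<le> cotree_sum {} (2/3)" by (simp add: power2_eq_square)
  then have "forest_gf {} (2/3) \<ge> 2" using forest_gf_cotree_sum[OF c] by simp
  then show False using forest_gf_less_2[OF _ x assms] by simp
qed

lemma rho_bounds: "0 < rho" "rho < 1" "x > rho \<Longrightarrow> \<not> converges {} x" "0 < x \<Longrightarrow> x < rho \<Longrightarrow> converges {} x"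
proof -
  have bdd: "bdd_above {x. converges {} x}" using converges_imp_le_two_thirds
    by (intro bdd_aboveI[of _ "2/3"]) auto
  have "1/10 \<le> rho" unfolding rho_def using converges_tenth bdd by (intro cSup_upper) auto
  then show "0 < rho" by simp
  have "rho \<le> 2/3" unfolding rho_def using converges_tenth converges_imp_le_two_thirds
    by (intro cSup_least) auto
  then show "rho < 1" by simp
  show "\<not> converges {} x" if "x > rho" using cSup_upper[OF _ bdd, of x] that unfolding rho_def by auto
  show "converges {} x" if x: "0 < x" "x < rho"
  proof -
    obtain y where "converges {} y" "x < y" using x(2) bdd converges_tenth
      unfolding rho_def by (subst (asm) less_cSup_iff) auto
    then show ?thesis using converges_mono x by (metis less_imp_le order_refl)
  qed
qed

text \<open>Below \<open>rho\<close> the bound F < 2 means T < (x + 1) / 2. Finite partial sums are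
  polynomials, so they keep this bound in the limit, which gives convergence at the radius
  itself.\<close>

lemma converges_rho: "converges {} rho" "forest_gf {} rho \<le> 2"
proof -
  have fin: "(\<Sum>t\<in>S. rho ^ leaves t) \<le> (rho + 1) / 2" if S: "finite S" "S \<subseteq> cotrees {}" for S
  proof (rule tendsto_le[of "at_left rho"])
    show "((\<lambda>x. (x + 1) / 2) \<longlongrightarrow> (rho + 1) / 2) (at_left rho)" by (intro tendsto_intros) auto
    show "((\<lambda>x. \<Sum>t\<in>S. x ^ leaves t) \<longlongrightarrow> (\<Sum>t\<in>S. rho ^ leaves t)) (at_left rho)"
      by (intro tendsto_intros)
    show "\<forall>\<^sub>F x in at_left rho. (\<Sum>t\<in>S. x ^ leaves t) \<le> (x + 1) / 2"
    proof (rule eventually_at_leftI[of 0])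
      fix x assume x: "x \<in> {0<..<rho}"
      then have c: "converges {} x" using rho_bounds(4) by auto
      obtain y where y: "x < y" "y < rho" using x dense by auto
      then have "forest_gf {} x < 2" using forest_gf_less_2[of x y] x rho_bounds(4)[of y] by auto
      then show "(\<Sum>t\<in>S. x ^ leaves t) \<le> (x + 1) / 2"
        using cotree_sum_ge[OF c S] forest_gf_cotree_sum[OF c] by simp
    qed (use rho_bounds in auto)
  qed auto
  then show c: "converges {} rho" using rho_bounds fin[OF finite_cotrees_le]
    by (intro converges_bounded[where k = 0 and u = "(rho + 1) / 2"]) (auto simp: cotrees_le_def)
  have "cotree_sum {} rho \<le> (rho + 1) / 2"
    unfolding cotree_sum_def using fin by (intro infsum_le_finite_sums convergesD(4)[OF c])
  then show "forest_gf {} rho \<le> 2" using forest_gf_cotree_sum[OF c] by simp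
qed

lemma cotrees_smaller:
  assumes "t \<in> cotrees {}" "leaves t < leaves L"
  shows "t \<in> cotrees {L}"
  using assms
proof induction
  case (Node M)
  then show ?case using leaves_child_le[of _ M] by (intro cotrees.Node) fastforce+
qed (auto intro: cotrees.Leaf)

text \<open>The children are smaller than the limb and thus cannot contain it. Hence the correction
  sum in \<open>cotree_sum_eq\<close> for \<open>X = {L}\<close> is exactly the single term for
  \<open>L\<close>.\<close>

lemma forest_of_limb:
  assumes "Node N \<in> cotrees {}" shows "N \<in> cforests2 {Node N}"
proof -
  have N: "N \<in> cforests2 {}" using assms by cases (auto simp: cforests2_def cforests_def)
  then have "t \<in> cotrees {Node N}" if "t \<in># N" for t
    using that leaves_child_less[OF N that] by (intro cotrees_smaller) (auto simp: cforests2_def cforests_def)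
  then show ?thesis using N by (auto simp: cforests2_def cforests_def)
qed

text \<open>The one-tree forest \<open>{#L#}\<close> is counted among all forests but not among the
  avoiding ones, leaving a gap of at least \<open>rho ^ leaves L\<close> below 2.\<close>

lemma forest_gf_avoiding_less_2:
  assumes "L \<in> cotrees {}"
  shows "forest_gf {L} rho < 2"
proof -
  have c: "converges {L} rho" using converges_mono[OF converges_rho(1)] rho_bounds by auto
  let ?g = "\<lambda>M. rho ^ leaves (Node M)"
  have L: "L \<notin> cotrees {L}" using cotrees_disjoint[of "{L}"] by auto
  have a: "(?g has_sum (forest_gf {L} rho + rho ^ leaves L)) (cforests {L} \<union> {{#L#}})"
    using has_sum_finite[of "{{#L#}}" ?g] L
    by (intro has_sum_Un_disjoint has_sum_cforests convergesD[OF c]) (auto simp: cforests_def)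
  have b: "(?g has_sum forest_gf {} rho) (cforests {})"
    by (intro has_sum_cforests convergesD[OF converges_rho(1)])
  have c: "cforests {L} \<union> {{#L#}} \<subseteq> cforests {}"
    using assms cotrees_antimono[of "{}" "{L}"] by (auto simp: cforests_def)
  have "forest_gf {L} rho + rho ^ leaves L \<le> forest_gf {} rho"
    using rho_bounds(1) by (intro has_sum_mono2[OF a b c]) auto
  moreover have "0 < rho ^ leaves L" using rho_bounds(1) by simp
  ultimately show ?thesis using converges_rho(2) by linarith
qed

section \<open>Cotrees avoiding a limb\<close>

text \<open>The part of the exponent of \<open>forest_gf\<close> of order at least two: the sum of
  x^(k |t|) / k over all k \<ge> 2. It is dominated by a multiple of the series at x^2, so it
  outlives the radius of convergence.\<close>

definition log_excess :: "cotree set \<Rightarrow> real \<Rightarrow> real" where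
  "log_excess X x = (\<Sum>\<^sub>\<infinity>t\<in>cotrees X. - ln (1 - x ^ leaves t) - x ^ leaves t)"

lemma neg_ln_minus_bounds:
  fixes y :: real assumes "0 \<le> y" "y \<le> c" "c < 1"
  shows "0 \<le> - ln (1 - y) - y" "- ln (1 - y) - y \<le> y\<^sup>2 / (1 - c)"
proof -
  have "- ln (1 - y) - y \<le> y / (1 - y) - y"
    using neg_ln_one_minus_bounds(3)[of y y] assms by simp
  also have "\<dots> = y\<^sup>2 / (1 - y)" using assms by (simp add: field_simps power2_eq_square)
  also have "\<dots> \<le> y\<^sup>2 / (1 - c)" using assms by (intro divide_left_mono) auto
  finally show "- ln (1 - y) - y \<le> y\<^sup>2 / (1 - c)" .
qed (use neg_ln_one_minus_bounds[OF assms] in simp)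

text \<open>On all of [0, r] the term of t is at most
  \<open>(r\<^sup>2) ^ leaves t / (1 - r)\<close>, so the Weierstrass test applies although the
  series itself may diverge at r.\<close>

lemma log_excess_summable_continuous:
  assumes r: "0 < r" "r < 1" and c: "converges X (r\<^sup>2)"
  shows "0 \<le> x \<Longrightarrow> x \<le> r \<Longrightarrow> (\<lambda>t. - ln (1 - x ^ leaves t) - x ^ leaves t) summable_on cotrees X"
    and "continuous_on {0..r} (log_excess X)"
proof -
  let ?g = "\<lambda>t x. - ln (1 - x ^ leaves t) - x ^ leaves t" and ?M = "\<lambda>t. (r\<^sup>2) ^ leaves t / (1 - r)"
  have M: "?M summable_on cotrees X"
    using summable_on_cmult_left[OF convergesD(4)[OF c], of "1 / (1 - r)"] by simp
  have bd: "0 \<le> ?g t x \<and> ?g t x \<le> ?M t" if "0 \<le> x" "x \<le> r" "t \<in> cotrees X" for t x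
  proof -
    have t: "0 \<le> x ^ leaves t" "x ^ leaves t \<le> r"
      using power_leaves_le[of x t X] that r by auto
    have "(x ^ leaves t)\<^sup>2 \<le> (r ^ leaves t)\<^sup>2" using that by (intro power_mono) auto
    then have "(x ^ leaves t)\<^sup>2 / (1 - r) \<le> ?M t" using r
      by (intro divide_right_mono) (auto simp flip: power_mult simp: mult.commute)
    then show ?thesis using neg_ln_minus_bounds[OF t r(2)] by auto
  qed
  show "(\<lambda>t. ?g t x) summable_on cotrees X" if "0 \<le> x" "x \<le> r"
    using bd that by (intro summable_on_comparison_test[OF M]) auto
  have "uniform_limit {0..r} (\<lambda>S x. \<Sum>t\<in>S. ?g t x) (\<lambda>x. \<Sum>\<^sub>\<infinity>t\<in>cotrees X. ?g t x) (finite_subsets_at_top (cotrees X))"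
    using bd by (intro Weierstrass_m_test_general[OF _ M]) (auto simp: abs_of_nonneg)
  moreover have "\<forall>\<^sub>F S in finite_subsets_at_top (cotrees X). continuous_on {0..r} (\<lambda>x. \<Sum>t\<in>S. ?g t x)"
  proof (rule eventually_finite_subsets_at_top_weakI)
    fix S assume S: "finite S" "S \<subseteq> cotrees X"
    have "1 - x ^ leaves t \<noteq> 0" if "x \<in> {0..r}" "t \<in> S" for x t
      using power_leaves_le(3)[of x t X] that S r by force
    then show "continuous_on {0..r} (\<lambda>x. \<Sum>t\<in>S. ?g t x)"
      by (intro continuous_intros) auto
  qed
  ultimately show "continuous_on {0..r} (log_excess X)"
    unfolding log_excess_def by (intro uniform_limit_theorem) auto
qed

text \<open>Separates the linear part, kept as a finite sum, from the excess, which is replaced by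
  its full value. Convergence of the cotree series at x is not presupposed.\<close>

lemma sum_neg_ln_le:
  assumes "0 < r" "r < 1" "converges X (r\<^sup>2)" "0 \<le> x" "x \<le> r"
  shows "(\<Sum>t\<in>cotrees_le X m. - ln (1 - x ^ leaves t))
    \<le> (\<Sum>t\<in>cotrees_le X m. x ^ leaves t) + log_excess X x" "0 \<le> log_excess X x"
proof -
  have nn: "0 \<le> - ln (1 - x ^ leaves t) - x ^ leaves t" if "t \<in> cotrees X" for t
    using power_leaves_le[of x t X] that assms by (intro neg_ln_minus_bounds(1)[of _ x]) auto
  have "(\<Sum>t\<in>cotrees_le X m. - ln (1 - x ^ leaves t) - x ^ leaves t) \<le> log_excess X x"
    unfolding log_excess_def using nn finite_cotrees_le
    by (intro finite_sum_le_infsum log_excess_summable_continuous(1)[OF assms]) (auto simp: cotrees_le_def)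
  then show "(\<Sum>t\<in>cotrees_le X m. - ln (1 - x ^ leaves t)) \<le> (\<Sum>t\<in>cotrees_le X m. x ^ leaves t) + log_excess X x"
    by (simp add: sum_subtractf)
  show "0 \<le> log_excess X x" unfolding log_excess_def using nn by (intro infsum_nonneg) auto
qed

lemma forest_gf_log_excess:
  assumes "converges X x" "0 < r" "r < 1" "converges X (r\<^sup>2)" "x \<le> r"
  shows "forest_gf X x = exp (cotree_sum X x + log_excess X x)"
proof -
  have x: "0 \<le> x" using convergesD assms(1) by auto
  have "(\<Sum>\<^sub>\<infinity>t\<in>cotrees X. x ^ leaves t + (- ln (1 - x ^ leaves t) - x ^ leaves t))
    = cotree_sum X x + log_excess X x"
    unfolding cotree_sum_def log_excess_def
    by (intro infsum_add convergesD(4)[OF assms(1)] log_excess_summable_continuous(1)[OF assms(2-4) x assms(5)])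
  then show ?thesis unfolding forest_gf_def by simp
qed

text \<open>The derivative exp (s + h) - 1 is nonnegative. This monotonicity carries the bound u
  from one partial sum to the next.\<close>

lemma exp_add_minus_mono:
  fixes s u h :: real
  assumes "s \<le> u" "0 \<le> s" "0 \<le> h"
  shows "exp (s + h) - s \<le> exp (u + h) - u"
proof -
  have "u - s \<le> exp (u - s) - 1" using exp_ge_add_one_self[of "u - s"] by linarith
  also have "\<dots> \<le> exp (s + h) * (exp (u - s) - 1)"
    using assms by (intro mult_right_le_imp_le[of 1, simplified] mult_le_cancel_right1[THEN iffD2]) auto
  also have "\<dots> = exp (u + h) - exp (s + h)" by (simp add: algebra_simps flip: exp_add)
  finally show ?thesis by linarith
qed

text \<open>The map \<open>s \<mapsto> x - x ^ k + exp (s + h) - 1 - s\<close>, with \<open>h\<close> the value of \<open>log_excess {L}\<close> at \<open>x\<close>, bounds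
  the next partial sum of the series in terms of the current one. At \<open>x = rho\<close> its derivative at the
  fixed point \<open>u0\<close> is \<open>B - 1 < 1\<close>, so it maps some \<open>u > u0\<close> strictly below \<open>u\<close>, and by continuity it
  still does so for some \<open>x > rho\<close>.\<close>

lemma avoiding_converges_beyond_rho:
  assumes L: "L \<in> cotrees {}" "L \<noteq> Leaf"
  shows "\<exists>r>rho. converges {L} r"
proof -
  \<comment> \<open>Any point strictly between \<open>rho\<close> and \<open>sqrt rho\<close> has
    its square below \<open>rho\<close>, which makes the excess continuous on an interval reaching
    past \<open>rho\<close>.\<close>
  define r0 where "r0 = (rho + sqrt rho) / 2"
  note rho = rho_bounds(1,2)
  have "rho < sqrt rho"
    using rho by (intro real_less_rsqrt) (simp add: power2_eq_square)
  then have r0: "rho < r0" "r0 < sqrt rho" "0 < r0" using rho by (auto simp: r0_def)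
  have "r0 < 1" using r0(2) rho real_sqrt_lt_1_iff[of rho] by linarith
  have "r0\<^sup>2 < (sqrt rho)\<^sup>2" using r0 by (intro power_strict_mono) auto
  then have "r0\<^sup>2 < rho" using rho by simp
  then have c0: "converges {L} (r0\<^sup>2)" using converges_mono[OF converges_rho(1), of "r0\<^sup>2" "{L}"] r0 by auto
  note G = r0(3) \<open>r0 < 1\<close> c0
  have cr: "converges {L} rho" using converges_mono[OF converges_rho(1)] rho by auto
  define u0 where "u0 = cotree_sum {L} rho"
  define k where "k = leaves L"
  define B where "B = forest_gf {L} rho"
  obtain N where N: "L = Node N" using L(2) by (cases L) auto
  have NL: "N \<in> cforests2 {L}" using forest_of_limb L(1) N by simp
  have "{L} \<inter> Node ` cforests2 {L} = {L}" using NL N by auto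
  then have u0: "u0 + rho ^ k = rho + (B - 1 - u0)"
    using cotree_sum_eq[of rho "{L}"] convergesD[OF cr] L(2) by (simp add: u0_def k_def B_def)
  have Bexp: "B = exp (u0 + log_excess {L} rho)"
    unfolding B_def u0_def using forest_gf_log_excess[OF cr G] r0 by simp
  have B: "0 < B" "B < 2" using Bexp forest_gf_avoiding_less_2[OF L(1)] by (auto simp: B_def)
  \<comment> \<open>With exp d \<le> 1 + d + d^2, moving from the fixed point to u0 + d raises the
    image by at most d * (B * (1 + d) - 1), which is less than d by this choice.\<close>
  obtain d where d: "0 < d" "d < 1" "B * (1 + d) < 2"
  proof
    show "0 < min (1/2) ((2 - B) / (2 * B))" "min (1/2) ((2 - B) / (2 * B)) < 1" using B by auto
    have "B * (1 + min (1/2) ((2 - B) / (2 * B))) \<le> B * (1 + (2 - B) / (2 * B))"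
      using B by (intro mult_left_mono) auto
    also have "\<dots> = B + (2 - B) / 2" using B by (simp add: field_simps)
    also have "\<dots> < 2" using B by (simp add: field_simps)
    finally show "B * (1 + min (1/2) ((2 - B) / (2 * B))) < 2" .
  qed
  define u where "u = u0 + d"
  define phi where "phi = (\<lambda>x. x - x ^ k + exp (u + log_excess {L} x) - 1 - u)"
  define s :: "nat \<Rightarrow> real \<Rightarrow> real" where "s = (\<lambda>m x. \<Sum>t\<in>cotrees_le {L} m. x ^ leaves t)"
  have "phi rho < u"
  proof -
    have "exp (u + log_excess {L} rho) = B * exp d" unfolding Bexp u_def by (simp flip: exp_add add: add_ac)
    also have "\<dots> \<le> B * (1 + d + d\<^sup>2)" using B d by (intro mult_left_mono exp_bound) auto
    finally have "phi rho \<le> (rho - rho ^ k - 1 - u0) + B + d * (B * (1 + d)) - d"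
      unfolding phi_def u_def by (simp add: algebra_simps power2_eq_square)
    also have "\<dots> = u0 + d * (B * (1 + d)) - d" using u0 by simp
    also have "\<dots> < u0 + d * 2 - d" using d by simp
    finally show ?thesis by (simp add: u_def)
  qed
  have "s k rho \<le> u0" unfolding s_def u0_def
    using finite_cotrees_le by (intro cotree_sum_ge[OF cr]) (auto simp: cotrees_le_def)
  then have "s k rho < u" using d by (simp add: u_def)
  have cont: "continuous_on {rho..r0} (log_excess {L})"
    using rho by (intro continuous_on_subset[OF log_excess_summable_continuous(2)[OF G]]) auto
  have "(phi \<longlongrightarrow> phi rho) (at rho within {rho..r0})"
  proof -
    have "continuous_on {rho..r0} phi" unfolding phi_def by (intro continuous_intros cont)
    then show ?thesis using r0 by (auto simp: continuous_on)
  qed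
  moreover have "(s k \<longlongrightarrow> s k rho) (at rho within {rho..r0})"
    unfolding s_def by (intro tendsto_intros)
  moreover have at: "at rho within {rho..r0} = at_right rho"
    using r0 by (intro at_within_Icc_at_right)
  ultimately have "\<forall>\<^sub>F x in at_right rho. phi x < u" "\<forall>\<^sub>F x in at_right rho. s k x < u"
    using order_tendstoD(2)[OF _ \<open>phi rho < u\<close>] order_tendstoD(2)[OF _ \<open>s k rho < u\<close>] by auto
  moreover have "\<forall>\<^sub>F x in at_right rho. x \<in> {rho<..<r0}"
    using r0 by (intro eventually_at_right_real)
  ultimately have "\<forall>\<^sub>F x in at_right rho. phi x < u \<and> s k x < u \<and> x \<in> {rho<..<r0}"
    by eventually_elim auto
  then obtain x where x: "phi x < u" "s k x < u" "rho < x" "x < r0"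
    using eventually_happens[of _ "at_right rho"] by auto
  have x01: "0 < x" "x < 1" using x rho G by auto
  \<comment> \<open>The induction starts at the size of \<open>L\<close>, because only from there on
    does the correction \<open>x ^ k\<close> appear in the recursive bound.\<close>
  have "s m x \<le> u" if "m \<ge> k" for m
    using that
  proof (induction m rule: dec_induct)
    case base
    then show ?case using x by simp
  next
    case (step m)
    let ?l = "\<Sum>t\<in>cotrees_le {L} m. - ln (1 - x ^ leaves t)"
    have g0: "0 \<le> log_excess {L} x" using sum_neg_ln_le(2)[OF G] x x01 by simp
    have s0: "0 \<le> s m x" unfolding s_def using x01 by (intro sum_nonneg) auto
    have "{L} \<inter> Node ` {M \<in> cforests2 {L}. leaves (Node M) \<le> Suc m} = {L}"
      using NL N step(1) by (auto simp: k_def)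
    then have "s (Suc m) x + x ^ k \<le> x + (exp ?l - 1 - s m x)"
      using sum_cotrees_le_Suc[of x "{L}" m] x01 L(2) by (simp add: s_def k_def)
    moreover have "exp ?l \<le> exp (s m x + log_excess {L} x)"
      using sum_neg_ln_le(1)[OF G, of x m] x x01 by (simp add: s_def)
    moreover have "exp (s m x + log_excess {L} x) - s m x \<le> exp (u + log_excess {L} x) - u"
      using step(3) s0 g0 by (rule exp_add_minus_mono)
    ultimately show ?case using x(1) unfolding phi_def by linarith
  qed
  then have "converges {L} x" using x01 unfolding s_def by (intro converges_bounded)
  then show ?thesis using x by blast
qed

section \<open>Growth of the number of cotrees\<close>

definition cforests_of_size :: "cotree set \<Rightarrow> nat \<Rightarrow> cotree multiset set" where
  "cforests_of_size X n = {M \<in> cforests X. leaves (Node M) = n}"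

definition cotrees_of_size :: "nat \<Rightarrow> cotree set" where
  "cotrees_of_size n = {t \<in> cotrees {}. leaves t = n}"

lemma finite_cforests_of_size: "finite (cforests_of_size X n)"
  by (rule finite_subset[OF _ finite_cforests[of X n]]) (auto simp: cforests_of_size_def)

lemma finite_cotrees_of_size: "finite (cotrees_of_size n)"
  by (rule finite_subset[OF _ finite_cotrees_le[of "{}" n]]) (auto simp: cotrees_of_size_def cotrees_le_def)

lemma card_cforests_le:
  assumes "converges X x"
  shows "real (card (cforests_of_size X n)) * x ^ n \<le> forest_gf X x"
proof -
  note h = has_sum_cforests[OF convergesD(2-4)[OF assms]]
  have "real (card (cforests_of_size X n)) * x ^ n = (\<Sum>M\<in>cforests_of_size X n. x ^ leaves (Node M))"
    by (simp add: cforests_of_size_def del: leaves.simps)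
  also have "\<dots> \<le> (\<Sum>\<^sub>\<infinity>M\<in>cforests X. x ^ leaves (Node M))"
    using convergesD(2)[OF assms] finite_cforests_of_size
    by (intro finite_sum_le_infsum has_sum_imp_summable[OF h]) (auto simp: cforests_of_size_def)
  also have "\<dots> = forest_gf X x" using h by (rule infsumI)
  finally show ?thesis .
qed

lemma card_cotrees_le_cforests: "card (cotrees_of_size n) \<le> card (cforests_of_size {} n)"
  by (rule card_inj_on_le[where f = "\<lambda>t. {#t#}", OF _ _ finite_cforests_of_size])
     (auto simp: cotrees_of_size_def cforests_of_size_def cforests_def inj_on_def)

lemma card_cotrees_pos:
  assumes "n \<ge> 1" shows "1 \<le> card (cotrees_of_size n)"
proof -
  have "\<exists>t. t \<in> cotrees_of_size n"
  proof (cases "n = 1")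
    case True
    then show ?thesis by (auto simp: cotrees_of_size_def intro!: exI[of _ Leaf] cotrees.Leaf)
  next
    case False
    have "Node (replicate_mset n Leaf) \<in> cotrees {}"
      using False assms by (intro cotrees.Node) (auto intro: cotrees.Leaf split: if_splits)
    then have "Node (replicate_mset n Leaf) \<in> cotrees_of_size n"
      by (simp add: cotrees_of_size_def sum_mset_replicate_mset)
    then show ?thesis by blast
  qed
  then have "cotrees_of_size n \<noteq> {}" by blast
  then show ?thesis using finite_cotrees_of_size[of n] by (simp add: Suc_le_eq card_gt_0_iff)
qed

text \<open>Join the two cotrees under a new root. The children of a root are unordered, and
  different sizes allow the ordered pair to be recovered.\<close>

lemma card_cotrees_mult_le:
  assumes "m \<noteq> n"
  shows "card (cotrees_of_size m) * card (cotrees_of_size n) \<le> card (cotrees_of_size (m + n))"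
proof -
  have "card (cotrees_of_size m \<times> cotrees_of_size n) \<le> card (cotrees_of_size (m + n))"
  proof (rule card_inj_on_le[where f = "\<lambda>(s, t). Node {#s, t#}"])
    show "inj_on (\<lambda>(s, t). Node {#s, t#}) (cotrees_of_size m \<times> cotrees_of_size n)"
      using assms by (auto simp: inj_on_def cotrees_of_size_def add_eq_conv_ex)
    show "(\<lambda>(s, t). Node {#s, t#}) ` (cotrees_of_size m \<times> cotrees_of_size n) \<subseteq> cotrees_of_size (m + n)"
      by (auto simp: cotrees_of_size_def intro!: cotrees.Node)
  qed (rule finite_cotrees_of_size)
  then show ?thesis by (simp add: card_cartesian_product)
qed

text \<open>Otherwise a geometric series of ratio \<open>x / r\<close> would dominate the cotree
  series at some x between \<open>rho\<close> and r, against the choice of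
  \<open>rho\<close>.\<close>

lemma cotrees_unbounded:
  assumes r: "rho < r" "r < 1"
  shows "\<exists>n\<ge>1. real (card (cotrees_of_size n)) * r ^ n > C"
proof (rule ccontr)
  assume "\<not> ?thesis"
  then have bd: "real (card (cotrees_of_size n)) * r ^ n \<le> C" if "n \<ge> 1" for n
    using that by (meson not_le)
  obtain x where x: "rho < x" "x < r" using r dense by blast
  have x0: "0 < x" "x < 1" using x r rho_bounds(1) by auto
  have C: "0 \<le> C" using bd[of 1] rho_bounds(1) r
    by (smt (verit) mult_nonneg_nonneg of_nat_0_le_iff power_one_right order_refl)
  have "converges {} x"
  proof (rule converges_bounded[where k = 0])
    fix m
    have "(\<Sum>t\<in>cotrees_le {} m. x ^ leaves t) = (\<Sum>n\<le>m. \<Sum>t | t \<in> cotrees_le {} m \<and> leaves t = n. x ^ leaves t)"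
      using finite_cotrees_le by (intro sum.group[symmetric]) (auto simp: cotrees_le_def)
    also have "\<dots> = (\<Sum>n\<le>m. real (card (cotrees_of_size n)) * x ^ n)"
    proof (rule sum.cong)
      fix n assume "n \<in> {..m}"
      then have "{t \<in> cotrees_le {} m. leaves t = n} = cotrees_of_size n"
        by (auto simp: cotrees_of_size_def cotrees_le_def)
      then show "(\<Sum>t | t \<in> cotrees_le {} m \<and> leaves t = n. x ^ leaves t)
        = real (card (cotrees_of_size n)) * x ^ n"
        by (simp add: cotrees_of_size_def)
    qed simp
    also have "\<dots> \<le> (\<Sum>n\<le>m. C * (x / r) ^ n)"
    proof (rule sum_mono)
      fix n
      show "real (card (cotrees_of_size n)) * x ^ n \<le> C * (x / r) ^ n"
      proof (cases "n = 0")
        case True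
        have "cotrees_of_size 0 = {}" unfolding cotrees_of_size_def using leaves_pos by fastforce
        then show ?thesis using True C by simp
      next
        case False
        have "real (card (cotrees_of_size n)) * x ^ n = (real (card (cotrees_of_size n)) * r ^ n) * (x / r) ^ n"
          using r rho_bounds(1) by (simp add: power_divide)
        also have "\<dots> \<le> C * (x / r) ^ n"
          using bd[of n] False x0 r rho_bounds(1) by (intro mult_right_mono) auto
        finally show ?thesis .
      qed
    qed
    also have "\<dots> = C * (\<Sum>n\<le>m. (x / r) ^ n)" by (simp add: sum_distrib_left)
    also have "\<dots> \<le> C * (1 / (1 - x / r))"
    proof (rule mult_left_mono[OF _ C])
      have q: "0 \<le> x / r" "x / r < 1" using x x0 r by auto
      then have "(\<lambda>n. (x / r) ^ n) sums (1 / (1 - x / r))" by (intro geometric_sums) auto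
      then show "(\<Sum>n\<le>m. (x / r) ^ n) \<le> 1 / (1 - x / r)"
        using q sum_le_suminf[of "\<lambda>n. (x / r) ^ n" "{..m}"] by (auto simp: sums_iff)
    qed
    finally show "(\<Sum>t\<in>cotrees_le {} m. x ^ leaves t) \<le> C * (1 / (1 - x / r))" .
  qed (use x0 in auto)
  then show False using rho_bounds(3) x by blast
qed

text \<open>A single N with weighted count above 2 suffices: by supermultiplicativity the weighted
  counts then at least double every N steps in each residue class.\<close>

lemma cotrees_at_top:
  assumes r: "rho < r" "r < 1"
  shows "filterlim (\<lambda>n. real (card (cotrees_of_size n)) * r ^ n) at_top sequentially"
proof -
  define u where "u = (\<lambda>n. real (card (cotrees_of_size n)) * r ^ n)"
  have r0: "0 < r" using r rho_bounds(1) by simp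
  obtain N where N: "N \<ge> 1" "u N > 2" using cotrees_unbounded[OF r] unfolding u_def by blast
  have upos: "0 < u n" if "n \<ge> 1" for n
    using card_cotrees_pos[OF that] r0 by (auto simp: u_def)
  \<comment> \<open>The restriction \<open>n > N\<close> provides the distinct sizes required by
    \<open>card_cotrees_mult_le\<close>.\<close>
  have step: "2 * u n \<le> u (n + N)" if "n > N" for n
  proof -
    have "2 * u n \<le> u N * u n" using N that upos[of n] by (intro mult_right_mono) auto
    also have "\<dots> = real (card (cotrees_of_size N) * card (cotrees_of_size n)) * r ^ (n + N)"
      by (simp add: u_def power_add)
    also have "\<dots> \<le> real (card (cotrees_of_size (N + n))) * r ^ (n + N)"
      using card_cotrees_mult_le[of N n] that r0 by (intro mult_right_mono of_nat_mono) auto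
    also have "\<dots> = u (n + N)" by (simp add: u_def add.commute)
    finally show ?thesis .
  qed
  \<comment> \<open>The interval holds one representative of every residue modulo N, all in the
    range where doubling is available.\<close>
  define c where "c = Min (u ` {N<..2 * N})"
  have c0: "0 < c" unfolding c_def using N upos by (subst Min_gr_iff) auto
  have low: "c * 2 ^ q \<le> u n" if "n > N + q * N" for q n
    using that
  proof (induction n arbitrary: q rule: less_induct)
    case (less n)
    show ?case
    proof (cases "n \<le> 2 * N")
      case True
      then have "q = 0" using less(2) N(1) by (cases q) auto
      moreover have "c \<le> u n" unfolding c_def using True less(2) by (intro Min_le) auto
      ultimately show ?thesis by simp
    next
      case False
      have "c * 2 ^ (q - 1) \<le> u (n - N)"
        using less(2) N(1) False by (intro less(1)) (cases q; auto)+
      moreover have "2 * u (n - N) \<le> u n" using step[of "n - N"] False by auto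
      moreover have "c * 2 ^ q \<le> 2 * (c * 2 ^ (q - 1))" using c0 by (cases q) auto
      ultimately show ?thesis by linarith
    qed
  qed
  show ?thesis unfolding u_def[symmetric] filterlim_at_top
  proof
    fix Z :: real
    obtain q where "Z / c < 2 ^ q" using real_arch_pow[of 2 "Z / c"] by auto
    then have "Z \<le> c * 2 ^ q" using c0 by (simp add: field_simps)
    then have "Z \<le> u n" if "n > N + q * N" for n using low[OF that] by linarith
    then show "\<forall>\<^sub>F n in sequentially. Z \<le> u n"
      by (auto simp: eventually_sequentially intro!: exI[of _ "Suc (N + q * N)"])
  qed
qed

theorem avoiding_forests_ratio:
  assumes L: "L \<in> cotrees {}" "L \<noteq> Leaf"
  shows "(\<lambda>n. real (card (cforests_of_size {L} n)) / real (card (cforests_of_size {} n))) \<longlonglongrightarrow> 0"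
proof -
  obtain r where r: "rho < r" "converges {L} r" using avoiding_converges_beyond_rho[OF L] by blast
  have r1: "r < 1" "0 < r" using convergesD[OF r(2)] by auto
  let ?u = "\<lambda>n. real (card (cotrees_of_size n)) * r ^ n"
  have "(\<lambda>n. forest_gf {L} r / ?u n) \<longlonglongrightarrow> 0"
    by (rule real_tendsto_divide_at_top[OF tendsto_const cotrees_at_top[OF r(1) r1(1)]])
  then show ?thesis
  proof (rule tendsto_sandwich[rotated -1])
    show "\<forall>\<^sub>F n in sequentially. real (card (cforests_of_size {L} n)) / real (card (cforests_of_size {} n)) \<le> forest_gf {L} r / ?u n"
      using eventually_ge_at_top[of 1]
    proof eventually_elim
      case (elim n)
      have t: "0 < card (cotrees_of_size n)" using card_cotrees_pos[OF elim] by simp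
      have "real (card (cforests_of_size {L} n)) / real (card (cforests_of_size {} n))
        \<le> real (card (cforests_of_size {L} n)) / real (card (cotrees_of_size n))"
        using card_cotrees_le_cforests[of n] t by (intro divide_left_mono) auto
      also have "\<dots> = (real (card (cforests_of_size {L} n)) * r ^ n) / ?u n" using r1 by simp
      also have "\<dots> \<le> forest_gf {L} r / ?u n"
        using card_cforests_le[OF r(2)] r1 by (intro divide_right_mono) auto
      finally show ?case .
    qed
  qed auto
qed

section \<open>Cographs as forests of cotrees\<close>

text \<open>\<open>limb t V E\<close> says that \<open>(V, E)\<close> is the connected cograph described by \<open>t\<close>: the complement of the
  disjoint union of the graphs described by the children of \<open>t\<close>.\<close>

inductive forest :: "cotree multiset \<Rightarrow> nat set \<Rightarrow> nat set set \<Rightarrow> bool"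
  and limb :: "cotree \<Rightarrow> nat set \<Rightarrow> nat set set \<Rightarrow> bool" where
  forest_empty: "forest {#} {} {}"
| forest_add: "forest M V1 E1 \<Longrightarrow> limb t V2 E2 \<Longrightarrow> V1 \<inter> V2 = {} \<Longrightarrow>
    forest (add_mset t M) (V1 \<union> V2) (E1 \<union> E2)"
| limb_Leaf: "limb Leaf {v} {}"
| limb_Node: "forest M V E \<Longrightarrow> 2 \<le> size M \<Longrightarrow> limb (Node M) V (all_edges V - E)"

lemma all_edges_mono: "V \<subseteq> W \<Longrightarrow> all_edges V \<subseteq> all_edges W"
  by (auto simp: all_edges_def)

lemma forest_limb_wf:
  "forest M V E \<Longrightarrow> M \<in> cforests {} \<and> E \<subseteq> all_edges V \<and> finite V \<and> card V = leaves (Node M)"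
  "limb t V E \<Longrightarrow> t \<in> cotrees {} \<and> E \<subseteq> all_edges V \<and> finite V \<and> card V = leaves t"
proof (induction rule: forest_limb.inducts)
  case (forest_add M V1 E1 t V2 E2)
  then show ?case using all_edges_mono[of V1 "V1 \<union> V2"] all_edges_mono[of V2 "V1 \<union> V2"]
    by (auto simp: cforests_def card_Un_disjoint)
next
  case (limb_Node M V E)
  then show ?case by (auto simp: cforests_def intro!: cotrees.Node)
qed (auto simp: cforests_def intro: cotrees.Leaf)

lemmas forest_wf = forest_limb_wf(1) and limb_wf = forest_limb_wf(2)

lemma forest_single: "limb t V E \<Longrightarrow> forest {#t#} V E"
  using forest_add[OF forest_empty, of t V E] by simp

lemma forest_induct [consumes 1, case_names empty add]:
  assumes "forest M V E" "P {#} {} {}"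
    and "\<And>M V1 E1 t V2 E2. forest M V1 E1 \<Longrightarrow> P M V1 E1 \<Longrightarrow> limb t V2 E2 \<Longrightarrow> V1 \<inter> V2 = {} \<Longrightarrow>
      P (add_mset t M) (V1 \<union> V2) (E1 \<union> E2)"
  shows "P M V E"
  using assms(1)
  by (induction rule: forest_limb.inducts(1)[where ?P2.0 = "\<lambda>_ _ _. True"]) (auto intro: assms(2,3))

lemma forest_emptyD: "forest {#} V E \<Longrightarrow> V = {} \<and> E = {}"
  by (auto elim: forest.cases)

lemma forest_singleD: "forest {#t#} V E \<Longrightarrow> limb t V E"
  by (erule forest.cases) (auto dest: forest_emptyD)

lemma forest_union:
  "forest M V1 E1 \<Longrightarrow> forest N V2 E2 \<Longrightarrow> V1 \<inter> V2 = {} \<Longrightarrow> forest (M + N) (V1 \<union> V2) (E1 \<union> E2)"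
proof (induction rule: forest_induct)
  case (add M V1 E1 t W F)
  then have "forest (add_mset t (M + N)) ((V1 \<union> V2) \<union> W) ((E1 \<union> E2) \<union> F)"
    by (intro forest_add) auto
  then show ?case by (simp add: Un_ac)
qed simp

lemma forest_exists_aux:
  assumes "\<And>t V. t \<in># M \<Longrightarrow> finite V \<Longrightarrow> card V = leaves t \<Longrightarrow> \<exists>E. limb t V E"
    and "finite V" "card V = leaves (Node M)"
  shows "\<exists>E. forest M V E"
  using assms
proof (induction M arbitrary: V)
  case empty
  then show ?case using forest_empty by auto
next
  case (add t M)
  obtain V2 where V2: "V2 \<subseteq> V" "card V2 = leaves t"
    using obtain_subset_with_card_n[of "leaves t" V] add.prems(3) by auto
  have fin: "finite V2" using V2 add.prems(2) finite_subset by blast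
  have c: "card (V - V2) = leaves (Node M)"
    using V2 fin add.prems(3) by (simp add: card_Diff_subset)
  obtain E1 where "forest M (V - V2) E1" using add.IH[OF _ _ c] add.prems by auto
  moreover obtain E2 where "limb t V2 E2" using add.prems(1)[of t V2] V2 fin by auto
  ultimately have "forest (add_mset t M) ((V - V2) \<union> V2) (E1 \<union> E2)" by (intro forest_add) auto
  then show ?case using V2(1) by (metis Diff_partition Un_commute)
qed

lemma limb_exists:
  "t \<in> cotrees {} \<Longrightarrow> finite V \<Longrightarrow> card V = leaves t \<Longrightarrow> \<exists>E. limb t V E"
proof (induction arbitrary: V rule: cotrees.induct)
  case Leaf
  then obtain v where "V = {v}" by (auto simp: card_1_singleton_iff)
  then show ?case using limb_Leaf by blast
next
  case (Node M)
  obtain E where "forest M V E" using forest_exists_aux[of M V] Node by blast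
  then show ?case using limb_Node Node.hyps by blast
qed

lemma forest_exists:
  assumes "M \<in> cforests {}" "finite V" "card V = leaves (Node M)"
  shows "\<exists>E. forest M V E"
  using assms limb_exists by (intro forest_exists_aux) (auto simp: cforests_def)

text \<open>Complementing puts a new root over two or more trees and removes the root of a single
  tree; the graphs with at most one vertex are their own complements.\<close>

lemma compl_forest:
  assumes "forest M V E"
  shows "\<exists>N. forest N V (all_edges V - E)"
proof -
  consider "M = {#}" | t where "M = {#t#}" | "2 \<le> size M"
    by (cases M) (auto simp: Suc_le_eq intro: nonempty_has_size[THEN iffD1])
  then show ?thesis
  proof cases
    case 1
    then have "V = {}" "E = {}" using forest_emptyD assms by auto
    moreover have "all_edges {} = {}" by (auto simp: all_edges_def)
    ultimately show ?thesis using forest_empty by auto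
  next
    case 2
    then have "limb t V E" using assms forest_singleD by blast
    then show ?thesis
    proof cases
      case (limb_Leaf v)
      have "card e \<noteq> 2" if "e \<subseteq> {v}" for e using card_mono[OF _ that] by simp
      then have "all_edges V - E = {}" using limb_Leaf by (auto simp: all_edges_def)
      then show ?thesis using limb_Leaf forest_single[OF forest_limb.limb_Leaf, of v] by auto
    next
      case (limb_Node N F)
      then have "all_edges V - E = F" using forest_wf by blast
      then show ?thesis using limb_Node by auto
    qed
  next
    case 3
    then show ?thesis using forest_single[OF limb_Node[OF assms]] by blast
  qed
qed

lemma cograph_forest: "cograph V E \<Longrightarrow> \<exists>M. forest M V E"
proof (induction rule: cograph.induct)
  case (single v)
  then show ?case using forest_single[OF limb_Leaf] by blast
next
  case (union V1 E1 V2 E2)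
  then show ?case using forest_union by blast
next
  case (compl V E)
  then show ?case using compl_forest by blast
qed

lemma forest_cograph:
  "forest M V E \<Longrightarrow> M \<noteq> {#} \<Longrightarrow> cograph V E" "limb t V E \<Longrightarrow> cograph V E"
proof (induction rule: forest_limb.inducts)
  case (forest_add M V1 E1 t V2 E2)
  then show ?case using forest_emptyD[of V1 E1] cograph.union by (cases "M = {#}") auto
next
  case (limb_Node M V E)
  then show ?case by (cases "M = {#}") (auto intro!: cograph.compl)
qed (auto intro: cograph.intros)

text \<open>Trees are added in some fixed order; this reorders the construction so that the tree
  containing a prescribed vertex comes last.\<close>

lemma forest_vertex_cases:
  assumes "forest M V E" "v \<in> V"
  obtains t N V1 E1 V2 E2 where "M = add_mset t N" "forest N V1 E1" "limb t V2 E2"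
    "V1 \<inter> V2 = {}" "V = V1 \<union> V2" "E = E1 \<union> E2" "v \<in> V2"
proof -
  have "\<exists>t N V1 E1 V2 E2. M = add_mset t N \<and> forest N V1 E1 \<and> limb t V2 E2 \<and>
    V1 \<inter> V2 = {} \<and> V = V1 \<union> V2 \<and> E = E1 \<union> E2 \<and> v \<in> V2"
    using assms
  proof (induction rule: forest_induct)
    case (add M V1 E1 t V2 E2)
    show ?case
    proof (cases "v \<in> V2")
      case True
      then show ?thesis using add by blast
    next
      case False
      then obtain s N W1 F1 W2 F2 where *: "M = add_mset s N" "forest N W1 F1" "limb s W2 F2"
        "W1 \<inter> W2 = {}" "V1 = W1 \<union> W2" "E1 = F1 \<union> F2" "v \<in> W2" using add by blast
      have "forest (add_mset t N) (W1 \<union> V2) (F1 \<union> E2)"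
        using * add by (intro forest_add) auto
      then show ?thesis using * add.hyps(3)
        by (rule_tac x = s in exI, rule_tac x = "add_mset t N" in exI, rule_tac x = "W1 \<union> V2" in exI,
            rule_tac x = "F1 \<union> E2" in exI, rule_tac x = W2 in exI, rule_tac x = F2 in exI) auto
    qed
  qed simp
  then show ?thesis using that by blast
qed

lemma forest_add_cases:
  assumes "forest (add_mset t N) V E"
  obtains V1 E1 V2 E2 where "forest N V1 E1" "limb t V2 E2"
    "V1 \<inter> V2 = {}" "V = V1 \<union> V2" "E = E1 \<union> E2"
proof -
  have "\<exists>V1 E1 V2 E2. forest (M - {#t#}) V1 E1 \<and> limb t V2 E2 \<and>
    V1 \<inter> V2 = {} \<and> V = V1 \<union> V2 \<and> E = E1 \<union> E2" if "forest M V E" "t \<in># M" for M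
    using that
  proof (induction rule: forest_induct)
    case (add M V1 E1 s V2 E2)
    show ?case
    proof (cases "s = t")
      case True
      then show ?thesis using add by auto
    next
      case False
      then obtain W1 F1 W2 F2 where *: "forest (M - {#t#}) W1 F1" "limb t W2 F2"
        "W1 \<inter> W2 = {}" "V1 = W1 \<union> W2" "E1 = F1 \<union> F2" using add by auto
      have "forest (add_mset s (M - {#t#})) (W1 \<union> V2) (F1 \<union> E2)"
        using * add by (intro forest_add) auto
      then have "forest (add_mset s M - {#t#}) (W1 \<union> V2) (F1 \<union> E2)"
        using False add by simp
      then show ?thesis using * add.hyps(3)
        by (rule_tac x = "W1 \<union> V2" in exI, rule_tac x = "F1 \<union> E2" in exI, rule_tac x = W2
          in exI, rule_tac x = F2 in exI) auto
    qed
  qed simp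
  from this[OF assms] show ?thesis using that by auto
qed

section \<open>Uniqueness of the cotree through connected components\<close>

definition reach :: "nat set set \<Rightarrow> (nat \<times> nat) set" where
  "reach E = {(u, v). {u, v} \<in> E}\<^sup>*"

lemma reach_mono: "E \<subseteq> F \<Longrightarrow> reach E \<subseteq> reach F"
  unfolding reach_def by (intro rtrancl_mono) auto

lemma all_edges_pair: "{u, v} \<in> all_edges V \<longleftrightarrow> u \<in> V \<and> v \<in> V \<and> u \<noteq> v"
  by (auto simp: all_edges_def card_insert_if)

text \<open>In the complement of a disjoint union with at least two parts, vertices of different
  parts are adjacent and vertices of the same part share a neighbour in another part.\<close>

lemma limb_connected:
  assumes "limb t V E" "u \<in> V" "v \<in> V" shows "(u, v) \<in> reach E"
  using assms(1)
proof cases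
  case (limb_Leaf w)
  then show ?thesis using assms by (simp add: reach_def)
next
  case (limb_Node M F)
  obtain s N V1 F1 V2 F2 where *: "M = add_mset s N" "forest N V1 F1" "limb s V2 F2"
    "V1 \<inter> V2 = {}" "V = V1 \<union> V2" "F = F1 \<union> F2" "u \<in> V2"
    using forest_vertex_cases[OF limb_Node(3) assms(2)] by blast
  have "1 \<le> size N" using limb_Node * by auto
  then have "1 \<le> card V1" using forest_wf[OF *(2)] size_le_leaves[of N "{}"] by auto
  then obtain w where w: "w \<in> V1" by fastforce
  have F: "F1 \<subseteq> all_edges V1" "F2 \<subseteq> all_edges V2" using *(2,3) forest_wf limb_wf by auto
  have e: "{a, b} \<in> E" if "a \<in> V1" "b \<in> V2" for a b
  proof -
    have "{a, b} \<notin> F1" "{a, b} \<notin> F2" using F that *(4) all_edges_pair by blast+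
    moreover have "{a, b} \<in> all_edges V" using that *(4,5) by (auto simp: all_edges_pair)
    ultimately show ?thesis using limb_Node(2) *(6) by simp
  qed
  have e': "{b, a} \<in> E" if "a \<in> V1" "b \<in> V2" for a b using e[OF that] by (simp add: insert_commute)
  show ?thesis
  proof (cases "v \<in> V1")
    case True
    then show ?thesis using e'[OF True *(7)] by (auto simp: reach_def)
  next
    case False
    then have "v \<in> V2" using assms(3) * by auto
    then have "(u, w) \<in> {(u, v). {u, v} \<in> E}" "(w, v) \<in> {(u, v). {u, v} \<in> E}"
      using e e' w *(7) by auto
    then show ?thesis unfolding reach_def by (meson converse_rtrancl_into_rtrancl r_into_rtrancl)
  qed
qed

text \<open>A limb is connected and no edge leaves it, so the whole graph and one vertex of the limb
  determine its vertices and edges.\<close>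

lemma limb_component:
  assumes "forest N V1 E1" "limb t V2 E2" "V1 \<inter> V2 = {}" "v \<in> V2"
  shows "V2 = {u. (v, u) \<in> reach (E1 \<union> E2)}" "E2 = {e \<in> E1 \<union> E2. e \<subseteq> V2}" "E1 = (E1 \<union> E2) - E2"
proof -
  have E: "E1 \<subseteq> all_edges V1" "E2 \<subseteq> all_edges V2" using assms forest_wf limb_wf by auto
  have "u \<in> V2" if "(v, u) \<in> reach (E1 \<union> E2)" for u
    using that unfolding reach_def
  proof (induction rule: rtrancl_induct)
    case (step a b)
    then have "{a, b} \<notin> E1" using E(1) assms(3) all_edges_pair by blast
    then show ?case using step E(2) all_edges_pair by blast
  qed (use assms in simp)
  then show "V2 = {u. (v, u) \<in> reach (E1 \<union> E2)}"
    using limb_connected[OF assms(2,4)] reach_mono[of E2 "E1 \<union> E2"] by blast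
  have no: "\<not> e \<subseteq> V2" if "e \<in> E1" for e
  proof
    assume "e \<subseteq> V2"
    moreover have "e \<subseteq> V1" "card e = 2" using that E(1) by (auto simp: all_edges_def)
    ultimately have "e = {}" using assms(3) by blast
    then show False using \<open>card e = 2\<close> by simp
  qed
  then show "E2 = {e \<in> E1 \<union> E2. e \<subseteq> V2}" using E(2) by (auto simp: all_edges_def)
  then show "E1 = (E1 \<union> E2) - E2" using no by blast
qed

text \<open>A vertex of the last limb singles out the same component in both decompositions, and the
  rest is induction. The number of vertices tells a leaf from a node.\<close>

lemma forest_limb_unique:
  "forest M V E \<Longrightarrow> forest M' V E \<Longrightarrow> M' = M"
  "limb t V E \<Longrightarrow> limb t' V E \<Longrightarrow> t' = t"
proof (induction arbitrary: M' and t' rule: forest_limb.inducts)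
  case forest_empty
  then show ?case using forest_wf[of M' "{}" "{}"] size_le_leaves[of M' "{}"] by (auto simp del: leaves.simps)
next
  case (forest_add M V1 E1 t V2 E2)
  have "1 \<le> card V2" using limb_wf[OF forest_add(2)] leaves_pos by auto
  then obtain v where v: "v \<in> V2" by fastforce
  obtain s N W1 F1 W2 F2 where *: "M' = add_mset s N" "forest N W1 F1" "limb s W2 F2"
    "W1 \<inter> W2 = {}" "V1 \<union> V2 = W1 \<union> W2" "E1 \<union> E2 = F1 \<union> F2" "v \<in> W2"
    using forest_vertex_cases[OF forest_add(6), of v] v by blast
  note a = limb_component[OF forest_add(1,2,3) v] and b = limb_component[OF *(2,3,4,7)]
  have V2: "W2 = V2" using a(1) b(1) *(6) by simp
  then have V1: "W1 = V1" using *(4,5) forest_add(3) by blast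
  have E2: "F2 = E2" using a(2) b(2) *(6) V2 by simp
  then have E1: "F1 = E1" using a(3) b(3) *(6) by simp
  show ?case using forest_add(4)[of N] forest_add(5)[of s] *(1-3) V1 V2 E1 E2 by simp
next
  case (limb_Leaf v)
  then show ?case
  proof cases
    case (limb_Node M F)
    then show ?thesis using forest_wf[of M "{v}" F] size_le_leaves[of M "{}"] by auto
  qed simp
next
  case (limb_Node M V E)
  note M = this
  from M(4) show ?case
  proof cases
    case (limb_Leaf v)
    then show ?thesis using forest_wf[OF M(1)] size_le_leaves[of M "{}"] M(2) by auto
  next
    case (limb_Node N F)
    then have "F = E" using forest_wf[of N V F] forest_wf[OF M(1)] by blast
    then show ?thesis using M(3) limb_Node by auto
  qed
qed

section \<open>Relabelling and isomorphism\<close>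

lemma image_all_edges:
  assumes "inj_on f V" "E \<subseteq> all_edges V"
  shows "(`) f ` (all_edges V - E) = all_edges (f ` V) - (`) f ` E"
proof -
  have inj: "inj_on ((`) f) (all_edges V)"
    using inj_on_image_Pow[OF assms(1)] by (rule inj_on_subset) (auto simp: all_edges_def)
  have "(`) f ` all_edges V = all_edges (f ` V)"
  proof
    show "(`) f ` all_edges V \<subseteq> all_edges (f ` V)"
      using assms(1) by (auto simp: all_edges_def card_image inj_on_subset)
    show "all_edges (f ` V) \<subseteq> (`) f ` all_edges V"
    proof
      fix e assume e: "e \<in> all_edges (f ` V)"
      then obtain d where d: "d \<subseteq> V" "e = f ` d" by (auto simp: all_edges_def subset_image_iff)
      then have "d \<in> all_edges V"
        using e assms(1) by (auto simp: all_edges_def card_image inj_on_subset)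
      then show "e \<in> (`) f ` all_edges V" using d by blast
    qed
  qed
  then show ?thesis using inj_on_image_set_diff[OF inj, of "all_edges V" E] assms(2) by auto
qed

lemma forest_limb_image:
  "forest M V E \<Longrightarrow> inj_on f V \<Longrightarrow> forest M (f ` V) ((`) f ` E)"
  "limb t V E \<Longrightarrow> inj_on f V \<Longrightarrow> limb t (f ` V) ((`) f ` E)"
proof (induction rule: forest_limb.inducts)
  case (forest_add M V1 E1 t V2 E2)
  then have "f ` V1 \<inter> f ` V2 = {}" by (auto simp: inj_on_def)
  then show ?case using forest_add unfolding image_Un
    by (intro forest_limb.forest_add) (auto simp: inj_on_Un)
next
  case (limb_Node M V E)
  then show ?case using forest_wf[of M V E] by (subst image_all_edges) (auto intro: forest_limb.limb_Node)
qed (auto intro: forest_limb.intros)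

text \<open>Isomorphisms of the parts are glued along the disjoint union. With
  \<open>forest_limb_image\<close> and \<open>forest_limb_unique\<close>, the multiset of cotrees is
  a complete isomorphism invariant.\<close>

lemma forest_limb_iso:
  "forest M V E \<Longrightarrow> forest M V' E' \<Longrightarrow> \<exists>f. bij_betw f V V' \<and> E' = (`) f ` E"
  "limb t V E \<Longrightarrow> limb t V' E' \<Longrightarrow> \<exists>f. bij_betw f V V' \<and> E' = (`) f ` E"
proof (induction arbitrary: V' E' and V' E' rule: forest_limb.inducts)
  case forest_empty
  then have "V' = {}" "E' = {}" using forest_emptyD by auto
  then show ?case by (auto intro!: exI[of _ id])
next
  case (forest_add M V1 E1 t V2 E2)
  obtain W1 F1 W2 F2 where *: "forest M W1 F1" "limb t W2 F2"
    "W1 \<inter> W2 = {}" "V' = W1 \<union> W2" "E' = F1 \<union> F2" using forest_add_cases[OF forest_add(6)] by blast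
  obtain f where f: "bij_betw f V1 W1" "F1 = (`) f ` E1" using forest_add(4)[OF *(1)] by blast
  obtain g where g: "bij_betw g V2 W2" "F2 = (`) g ` E2" using forest_add(5)[OF *(2)] by blast
  have E: "E1 \<subseteq> all_edges V1" "E2 \<subseteq> all_edges V2" using forest_add(1,2) forest_wf limb_wf by auto
  define h where "h = (\<lambda>v. if v \<in> V1 then f v else g v)"
  have h1: "h v = f v" if "v \<in> V1" for v using that by (simp add: h_def)
  have h2: "h v = g v" if "v \<in> V2" for v using that forest_add(3) by (auto simp: h_def)
  have "bij_betw h V1 W1" using f(1) h1 by (simp cong: bij_betw_cong)
  moreover have "bij_betw h V2 W2" using g(1) h2 by (simp cong: bij_betw_cong)
  ultimately have "bij_betw h (V1 \<union> V2) V'" using *(3,4) bij_betw_combine by blast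
  moreover have "(`) h ` E1 = F1" unfolding f(2)
  proof (rule image_cong[OF refl])
    fix e assume "e \<in> E1"
    then have "e \<subseteq> V1" using E(1) by (auto simp: all_edges_def)
    then show "h ` e = f ` e" using h1 by (intro image_cong) auto
  qed
  moreover have "(`) h ` E2 = F2" unfolding g(2)
  proof (rule image_cong[OF refl])
    fix e assume "e \<in> E2"
    then have "e \<subseteq> V2" using E(2) by (auto simp: all_edges_def)
    then show "h ` e = g ` e" using h2 by (intro image_cong) auto
  qed
  ultimately show ?case using *(5) by (metis image_Un)
next
  case (limb_Leaf v)
  then obtain w where "V' = {w}" "E' = {}" by (auto elim: limb.cases)
  then show ?case by (auto intro!: exI[of _ "\<lambda>_. w"] simp: bij_betw_def)
next
  case (limb_Node M V E)
  from limb_Node(4) obtain F where F: "forest M V' F" "E' = all_edges V' - F" by cases auto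
  obtain f where f: "bij_betw f V V'" "F = (`) f ` E" using limb_Node(3)[OF F(1)] by blast
  have "(`) f ` (all_edges V - E) = E'"
    using image_all_edges[of f V E] f F(2) forest_wf[OF limb_Node(1)] by (auto simp: bij_betw_def)
  then show ?case using f by blast
qed

section \<open>Generalised characteristic polynomials\<close>


definition adj :: "nat set set \<Rightarrow> nat \<Rightarrow> nat \<Rightarrow> complex" where
  "adj E u v = (if {u, v} \<in> E then 1 else 0)"

text \<open>This is x I - A - t J with the vertices in the order \<open>vs\<close>. A free order
  lets disjoint unions become block diagonal by appending lists; by
  \<open>det_shifted_mat_permute\<close> it does not affect the determinant.\<close>

definition shifted_mat :: "nat set set \<Rightarrow> nat list \<Rightarrow> complex \<Rightarrow> complex \<Rightarrow> complex mat" where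
  "shifted_mat E vs x t = mat (length vs) (length vs)
     (\<lambda>(i, j). (if i = j then x else 0) - adj E (vs ! i) (vs ! j) - t)"

lemma shifted_mat_carrier [simp]: "shifted_mat E vs x t \<in> carrier_mat (length vs) (length vs)"
  by (simp add: shifted_mat_def)

text \<open>The matrix determinant lemma: a bordered matrix is factored in two ways, eliminating one
  or the other diagonal block, and the determinants are compared.\<close>

lemma det_rank_one_update:
  fixes w :: "complex vec"
  assumes w: "w \<in> carrier_vec n"
  shows "det (mat n n (\<lambda>(i, j). (if i = j then 1 else 0) - t * w $ i)) = 1 - t * (\<Sum>i<n. w $ i)"
proof -
  define K where "K = mat n n (\<lambda>(i, j). (if i = j then 1 else 0) - t * w $ i)"
  define B where "B = mat 1 n (\<lambda>(i, j). t)"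
  define C where "C = mat n 1 (\<lambda>(i, j). w $ i)"
  define S where "S = mat 1 1 (\<lambda>(i, j). 1 - t * (\<Sum>i<n. w $ i))"
  have car: "K \<in> carrier_mat n n" "B \<in> carrier_mat 1 n" "C \<in> carrier_mat n 1" "S \<in> carrier_mat 1 1"
    by (auto simp: K_def B_def C_def S_def)
  have CB: "C * B + K = 1\<^sub>m n"
    by (rule eq_matI) (auto simp: K_def B_def C_def scalar_prod_def)
  have BC: "S + B * C = 1\<^sub>m 1"
    by (rule eq_matI) (auto simp: S_def B_def C_def scalar_prod_def sum_distrib_left lessThan_atLeast0)
  let ?F = "four_block_mat (1\<^sub>m 1) B C (1\<^sub>m n)"
  let ?P = "four_block_mat (1\<^sub>m 1) (0\<^sub>m 1 n) C (1\<^sub>m n)"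
  let ?Q = "four_block_mat (1\<^sub>m 1) B (0\<^sub>m n 1) K"
  let ?R = "four_block_mat S B (0\<^sub>m n 1) (1\<^sub>m n)"
  have cars: "?P \<in> carrier_mat (1 + n) (1 + n)" "?Q \<in> carrier_mat (1 + n) (1 + n)"
    "?R \<in> carrier_mat (1 + n) (1 + n)" using car by auto
  have dets: "det ?P = 1" "det ?Q = det K" "det ?R = det S"
    using det_four_block_mat_upper_right_zero[of "1\<^sub>m 1" 1 "0\<^sub>m 1 n" n C "1\<^sub>m n"]
      det_four_block_mat_lower_left_zero[of "1\<^sub>m 1" 1 B n "0\<^sub>m n 1" K]
      det_four_block_mat_lower_left_zero[of S 1 B n "0\<^sub>m n 1" "1\<^sub>m n"] car by auto
  have "?F = ?P * ?Q"
    using car CB by (subst mult_four_block_mat[of _ 1 1 _ n _ n _ _ 1 _ n]) auto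
  then have 1: "det ?F = det K" using det_mult[OF cars(1,2)] dets by simp
  have "?F = ?R * ?P"
    using car BC by (subst mult_four_block_mat[of _ 1 1 _ n _ n _ _ 1 _ n]) auto
  then have 2: "det ?F = det S" using det_mult[OF cars(3,1)] dets by simp
  have "det S = 1 - t * (\<Sum>i<n. w $ i)"
    by (subst det_def'[OF car(4)]) (simp add: S_def)
  then show ?thesis using 1 2 by (simp add: K_def)
qed

text \<open>Since M w is the all-ones vector, subtracting t J from M equals multiplying M by a rank
  one update of the identity.\<close>

lemma det_minus_const:
  fixes M :: "complex mat"
  assumes M: "M \<in> carrier_mat n n" and w: "w \<in> carrier_vec n" "M *\<^sub>v w = vec n (\<lambda>_. 1)"
  shows "det (mat n n (\<lambda>(i, j). M $$ (i, j) - t)) = det M * (1 - t * (\<Sum>i<n. w $ i))"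
proof -
  let ?K = "mat n n (\<lambda>(i, j). (if i = j then 1 else 0) - t * w $ i)"
  have "mat n n (\<lambda>(i, j). M $$ (i, j) - t) = M * ?K"
  proof (rule eq_matI)
    fix i j assume "i < dim_row (M * ?K)" "j < dim_col (M * ?K)"
    then have ij: "i < n" "j < n" using M by auto
    have "(\<Sum>k = 0..<n. M $$ (i, k) * w $ k) = (M *\<^sub>v w) $ i"
      using ij M w(1) by (auto simp: scalar_prod_def)
    also have "\<dots> = 1" using ij by (simp add: w(2))
    finally have e: "(\<Sum>k = 0..<n. M $$ (i, k) * w $ k) = 1" .
    have "(M * ?K) $$ (i, j) = (\<Sum>k = 0..<n. M $$ (i, k) * ((if k = j then 1 else 0) - t * w $ k))"
      using ij M by (auto simp: scalar_prod_def)
    also have "\<dots> = (\<Sum>k = 0..<n. (if k = j then M $$ (i, k) else 0) - t * (M $$ (i, k) * w $ k))"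
      by (intro sum.cong) (auto simp: algebra_simps)
    also have "\<dots> = M $$ (i, j) - t"
      using ij e by (simp add: sum_subtractf flip: sum_distrib_left)
    finally show "mat n n (\<lambda>(i, j). M $$ (i, j) - t) $$ (i, j) = (M * ?K) $$ (i, j)" using ij by simp
  qed (use M in auto)
  then show ?thesis using det_mult[OF M, of ?K] det_rank_one_update[OF w(1)] by simp
qed

lemma solve_ones:
  fixes M :: "complex mat"
  assumes M: "M \<in> carrier_mat n n" "det M \<noteq> 0"
  obtains w where "w \<in> carrier_vec n" "M *\<^sub>v w = vec n (\<lambda>_. 1)"
proof -
  obtain B where B: "B \<in> carrier_mat n n" "M * B = 1\<^sub>m n"
    using det_non_zero_imp_unit[OF M] by (auto simp: Units_def ring_mat_def)
  have "M *\<^sub>v (B *\<^sub>v vec n (\<lambda>_. 1)) = vec n (\<lambda>_. 1)"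
    using M B by (subst assoc_mult_mat_vec[symmetric, of _ n n _ n]) auto
  then show ?thesis using that[of "B *\<^sub>v vec n (\<lambda>_. 1)"] B by auto
qed

lemma shifted_mat_shift: "shifted_mat E vs x t
  = mat (length vs) (length vs) (\<lambda>(i, j). shifted_mat E vs x 0 $$ (i, j) - t)"
  by (rule eq_matI) (auto simp: shifted_mat_def)

lemma poly_char_poly_shifted_mat:
  "poly (char_poly (mat (length vs) (length vs) (\<lambda>(i, j). adj E (vs ! i) (vs ! j)))) x
    = det (shifted_mat E vs x 0)"
proof -
  let ?A = "mat (length vs) (length vs) (\<lambda>(i, j). adj E (vs ! i) (vs ! j))"
  have "- char_matrix ?A x = shifted_mat E vs x 0"
    by (rule eq_matI) (auto simp: char_matrix_def shifted_mat_def)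
  then show ?thesis using char_poly_matrix[of ?A "length vs" x] by simp
qed

lemma eventually_det_nonzero: "\<forall>\<^sub>F x in cofinite. det (shifted_mat E vs x 0) \<noteq> 0"
proof -
  let ?A = "mat (length vs) (length vs) (\<lambda>(i, j). adj E (vs ! i) (vs ! j))"
  have "char_poly ?A \<noteq> 0" using degree_monic_char_poly[of ?A "length vs"] by auto
  then show ?thesis
    using poly_roots_finite[of "char_poly ?A"] by (simp add: eventually_cofinite poly_char_poly_shifted_mat)
qed

text \<open>\<open>w\<close> is the walk generating function \<open>e\<^sup>T (x I - A)\<^sup>-\<^sup>1 e\<close> with \<open>e\<close> the all-ones vector. Exempting finitely
  many \<open>x\<close> lets \<open>x I - A\<close> be assumed invertible.\<close>

definition spectral_data :: "nat set set \<Rightarrow> nat list \<Rightarrow> (complex \<Rightarrow> complex) \<Rightarrow> (complex \<Rightarrow> complex) \<Rightarrow> bool" where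
  "spectral_data E vs p w \<longleftrightarrow> (\<forall>\<^sub>F x in cofinite. \<forall>t. det (shifted_mat E vs x t) = p x * (1 - t * w x))"

text \<open>The matrix at t = 0 is block diagonal, so determinants multiply; stacking the solutions
  of M u = e for both blocks solves the joint system, so the walk functions add.\<close>

lemma spectral_data_append:
  assumes d1: "spectral_data E1 vs1 p1 w1" and d2: "spectral_data E2 vs2 p2 w2"
    and "\<And>e. e \<in> E1 \<Longrightarrow> e \<subseteq> set vs1" "\<And>e. e \<in> E2 \<Longrightarrow> e \<subseteq> set vs2" "set vs1 \<inter> set vs2 = {}"
  shows "spectral_data (E1 \<union> E2) (vs1 @ vs2) (\<lambda>x. p1 x * p2 x) (\<lambda>x. w1 x + w2 x)"
  using d1 d2 eventually_det_nonzero[of E1 vs1] eventually_det_nonzero[of E2 vs2]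
  unfolding spectral_data_def
proof eventually_elim
  case (elim x)
  let ?n1 = "length vs1" and ?n2 = "length vs2"
  let ?M1 = "shifted_mat E1 vs1 x 0" and ?M2 = "shifted_mat E2 vs2 x 0" and ?M
    = "shifted_mat (E1 \<union> E2) (vs1 @ vs2) x 0"
  have M: "?M = four_block_mat ?M1 (0\<^sub>m ?n1 ?n2) (0\<^sub>m ?n2 ?n1) ?M2"
  proof (rule eq_matI)
    fix i j assume "i < dim_row (four_block_mat ?M1 (0\<^sub>m ?n1 ?n2) (0\<^sub>m ?n2 ?n1) ?M2)"
      "j < dim_col (four_block_mat ?M1 (0\<^sub>m ?n1 ?n2) (0\<^sub>m ?n2 ?n1) ?M2)"
    then have ij: "i < ?n1 + ?n2" "j < ?n1 + ?n2" by (auto simp: shifted_mat_def)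
    have c1: "adj (E1 \<union> E2) u v = adj E1 u v" if "u \<in> set vs1" "v \<in> set vs1" for u v
      using that assms(4)[of "{u, v}"] assms(5) by (auto simp: adj_def)
    have c2: "adj (E1 \<union> E2) u v = adj E2 u v" if "u \<in> set vs2" "v \<in> set vs2" for u v
      using that assms(3)[of "{u, v}"] assms(5) by (auto simp: adj_def)
    have c3: "adj (E1 \<union> E2) u v = 0" "adj (E1 \<union> E2) v u = 0" if "u \<in> set vs1" "v \<in> set vs2" for u v
      using that assms(3,4)[of "{u, v}"] assms(5) by (auto simp: adj_def insert_commute)
    show "?M $$ (i, j) = four_block_mat ?M1 (0\<^sub>m ?n1 ?n2) (0\<^sub>m ?n2 ?n1) ?M2 $$ (i, j)"
      using ij by (cases "i < ?n1"; cases "j < ?n1") (auto simp: shifted_mat_def nth_append c1 c2 c3)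
  qed (auto simp: shifted_mat_def)
  have dM: "det ?M = det ?M1 * det ?M2"
    unfolding M by (rule det_four_block_mat_upper_right_zero) auto
  obtain u1 where u1: "u1 \<in> carrier_vec ?n1" "?M1 *\<^sub>v u1 = vec ?n1 (\<lambda>_. 1)"
    using solve_ones[OF shifted_mat_carrier elim(3)] .
  obtain u2 where u2: "u2 \<in> carrier_vec ?n2" "?M2 *\<^sub>v u2 = vec ?n2 (\<lambda>_. 1)"
    using solve_ones[OF shifted_mat_carrier elim(4)] .
  have r1: "det (shifted_mat E1 vs1 x t) = det ?M1 * (1 - t * (\<Sum>i<?n1. u1 $ i))" for t
    by (subst shifted_mat_shift) (rule det_minus_const[OF shifted_mat_carrier u1])
  have r2: "det (shifted_mat E2 vs2 x t) = det ?M2 * (1 - t * (\<Sum>i<?n2. u2 $ i))" for t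
    by (subst shifted_mat_shift) (rule det_minus_const[OF shifted_mat_carrier u2])
  \<comment> \<open>The value t = 0 recovers \<open>p1\<close> and \<open>p2\<close>; the value t =
    1 then recovers \<open>w1\<close> and \<open>w2\<close>.\<close>
  have p1: "p1 x = det ?M1" and p2: "p2 x = det ?M2" using elim(1,2)
    by (metis mult_zero_left diff_zero mult_1_right)+
  have "p1 x * (1 - 1 * w1 x) = det ?M1 * (1 - 1 * (\<Sum>i<?n1. u1 $ i))" using r1[of 1] elim(1) by metis
  then have w1: "w1 x = (\<Sum>i<?n1. u1 $ i)" using elim(3) unfolding p1 by simp
  have "p2 x * (1 - 1 * w2 x) = det ?M2 * (1 - 1 * (\<Sum>i<?n2. u2 $ i))" using r2[of 1] elim(2) by metis
  then have w2: "w2 x = (\<Sum>i<?n2. u2 $ i)" using elim(4) unfolding p2 by simp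
  let ?u = "u1 @\<^sub>v u2"
  have z: "0\<^sub>m ?n1 ?n2 *\<^sub>v u2 = 0\<^sub>v ?n1" "0\<^sub>m ?n2 ?n1 *\<^sub>v u1 = 0\<^sub>v ?n2"
    using u1(1) u2(1) by (auto intro!: eq_vecI)
  have "?M *\<^sub>v ?u = (?M1 *\<^sub>v u1) @\<^sub>v (?M2 *\<^sub>v u2)"
    unfolding M using u1(1) u2(1)
    by (subst four_block_mat_mult_vec[of _ ?n1 ?n1 _ ?n2 _ ?n2]) (auto simp: z u1(2) u2(2))
  also have "\<dots> = vec (?n1 + ?n2) (\<lambda>_. 1)"
    unfolding u1 u2 by (rule eq_vecI) auto
  finally have u: "?M *\<^sub>v ?u = vec (?n1 + ?n2) (\<lambda>_. 1)" .
  have s: "(\<Sum>i<?n1 + ?n2. ?u $ i) = w1 x + w2 x"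
  proof -
    have "(\<Sum>i<a + b. f i) = (\<Sum>i<a. f i) + (\<Sum>i<b. f (a + i))" for a b and f :: "nat \<Rightarrow> complex"
      by (induction b) auto
    then show ?thesis unfolding w1 w2 using u1(1) u2(1) by simp
  qed
  show ?case
  proof
    fix t
    have c: "?M \<in> carrier_mat (?n1 + ?n2) (?n1 + ?n2)"
      using shifted_mat_carrier[of "E1 \<union> E2" "vs1 @ vs2" x 0] by simp
    have "?u \<in> carrier_vec (?n1 + ?n2)" using u1(1) u2(1) by simp
    note det_minus_const[OF c this u, of t]
    then have "det (shifted_mat (E1 \<union> E2) (vs1 @ vs2) x t) = det ?M * (1 - t * (\<Sum>i<?n1 + ?n2. ?u $ i))"
      by (subst shifted_mat_shift) (simp only: length_append)
    then show "det (shifted_mat (E1 \<union> E2) (vs1 @ vs2) x t) = p1 x * p2 x * (1 - t * (w1 x + w2 x))"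
      by (simp only: s dM p1 p2)
  qed
qed

lemma eventually_reflect:
  "eventually P cofinite \<Longrightarrow> \<forall>\<^sub>F x in cofinite. P (- 1 - x :: complex)"
proof -
  assume "eventually P cofinite"
  then have "finite ((\<lambda>x. - 1 - x) ` {x. \<not> P x})" by (simp add: eventually_cofinite)
  moreover have "{x. \<not> P (- 1 - x)} \<subseteq> (\<lambda>x. - 1 - x) ` {x. \<not> P x}"
    by (auto intro!: image_eqI[where x = "- 1 - _"])
  ultimately show ?thesis unfolding eventually_cofinite by (rule rev_finite_subset)
qed

text \<open>With \<open>y = -1 - x\<close>, the matrix \<open>x I - (J - I - A) - t J\<close> is \<open>- (y I - A + (1 + t) J)\<close>.\<close>

lemma spectral_data_compl:
  assumes d: "spectral_data E vs p w" and vs: "distinct vs" and E: "E \<subseteq> all_edges (set vs)"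
  shows "spectral_data (all_edges (set vs) - E) vs (\<lambda>x. (-1) ^ length vs * p (- 1 - x) * (1 + w (- 1 - x)))
    (\<lambda>x. - w (- 1 - x) / (1 + w (- 1 - x)))"
  using eventually_reflect[OF d[unfolded spectral_data_def]]
    eventually_det_nonzero[of "all_edges (set vs) - E" vs]
  unfolding spectral_data_def
proof eventually_elim
  case (elim x)
  let ?F = "all_edges (set vs) - E" and ?n = "length vs"
  have "shifted_mat ?F vs x t = (-1) \<cdot>\<^sub>m shifted_mat E vs (- 1 - x) (- 1 - t)" for t
  proof (rule eq_matI)
    fix i j assume "i < dim_row ((-1) \<cdot>\<^sub>m shifted_mat E vs (- 1 - x) (- 1 - t))"
      "j < dim_col ((-1) \<cdot>\<^sub>m shifted_mat E vs (- 1 - x) (- 1 - t))"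
    then have ij: "i < ?n" "j < ?n" by (auto simp: shifted_mat_def)
    have "vs ! i = vs ! j \<longleftrightarrow> i = j" using ij vs by (simp add: nth_eq_iff_index_eq)
    then show "shifted_mat ?F vs x t $$ (i, j) = ((-1) \<cdot>\<^sub>m shifted_mat E vs (- 1 - x) (- 1 - t)) $$ (i, j)"
      using ij E by (auto simp: shifted_mat_def adj_def all_edges_def card_insert_if)
  qed (auto simp: shifted_mat_def)
  then have eq: "det (shifted_mat ?F vs x t) = (-1) ^ ?n * (p (- 1 - x) * (1 - (- 1 - t) * w (- 1 - x)))" for t
    using elim(1) by (simp add: shifted_mat_def)
  \<comment> \<open>The determinant of the complement at t = 0 has this factor, so its nonvanishing
    justifies the division.\<close>
  have "1 + w (- 1 - x) \<noteq> 0" using elim(2) eq[of 0] by auto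
  then show ?case unfolding eq by (auto simp: field_simps)
qed

lemma spectral_data_single: "spectral_data {} [v] (\<lambda>x. x) (\<lambda>x. 1 / x)"
proof -
  have "det (shifted_mat {} [v] x t) = x - t" for x t
    by (subst det_def'[of _ 1]) (auto simp: shifted_mat_def adj_def)
  moreover have "\<forall>\<^sub>F x :: complex in cofinite. x \<noteq> 0" by (simp add: eventually_cofinite)
  ultimately show ?thesis unfolding spectral_data_def by (auto elim!: eventually_mono simp: field_simps)
qed

text \<open>Rows and columns undergo the same permutation, so the two signs cancel; columns are
  reached by transposing.\<close>

lemma det_shifted_mat_permute:
  assumes "mset vs = mset us"
  shows "det (shifted_mat E vs x t) = det (shifted_mat E us x t)"
proof -
  obtain q where q: "q permutes {..<length us}" "permute_list q us = vs"
    using mset_eq_permutation[OF assms] by blast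
  let ?n = "length us"
  let ?A = "shifted_mat E us x t"
  have q': "q permutes {0..<?n}" using q by (simp add: lessThan_atLeast0)
  have len: "length vs = ?n" using assms mset_eq_length by blast
  let ?T = "mat ?n ?n (\<lambda>(i, j). transpose_mat ?A $$ (q i, j))"
  have qi: "q i < ?n" if "i < ?n" for i using permutes_in_image[OF q'] that by auto
  have vs: "vs ! i = us ! q i" if "i < ?n" for i using q that by (auto simp: permute_list_nth)
  have "shifted_mat E vs x t = mat ?n ?n (\<lambda>(i, j). transpose_mat ?T $$ (q i, j))"
    using qi vs len permutes_inj[OF q'] by (intro eq_matI) (auto simp: shifted_mat_def inj_eq)
  then have "det (shifted_mat E vs x t) = signof q * det (transpose_mat ?T)"
    using det_permute_rows[OF _ q', of "transpose_mat ?T"] by simp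
  also have "det (transpose_mat ?T) = det ?T" by (rule det_transpose[of _ ?n]) simp
  also have "\<dots> = signof q * det (transpose_mat ?A)" by (rule det_permute_rows[OF _ q']) simp
  also have "det (transpose_mat ?A) = det ?A" by (rule det_transpose[of _ ?n]) simp
  finally show ?thesis by (cases q rule: sign_cases) auto
qed


section \<open>Spectral data computed along the cotree\<close>

text \<open>The node case is \<open>spectral_data_compl\<close> applied to the disjoint union of the
  children. Division by zero gives arbitrary values at finitely many points, which statements about
  cofinitely many x ignore. The mapped multiset is the shape that primitive recursion dictates;
  \<open>walk_Node\<close> restates it.\<close>

primrec walk :: "cotree \<Rightarrow> complex \<Rightarrow> complex" where
  "walk Leaf = (\<lambda>x. 1 / x)"
| "walk (Node M) = (\<lambda>x. - (\<Sum>f\<in>#image_mset walk M. f (- 1 - x)) / (1 + (\<Sum>f\<in>#image_mset walk M. f (- 1 - x))))"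

primrec cpoly :: "cotree \<Rightarrow> complex \<Rightarrow> complex" where
  "cpoly Leaf = (\<lambda>x. x)"
| "cpoly (Node M) = (\<lambda>x. (-1) ^ leaves (Node M) * (\<Prod>f\<in>#image_mset cpoly M. f (- 1 - x)) *
     (1 + (\<Sum>t\<in>#M. walk t (- 1 - x))))"

definition forest_walk :: "cotree multiset \<Rightarrow> complex \<Rightarrow> complex" where
  "forest_walk M x = (\<Sum>t\<in>#M. walk t x)"

definition forest_cpoly :: "cotree multiset \<Rightarrow> complex \<Rightarrow> complex" where
  "forest_cpoly M x = (\<Prod>t\<in>#M. cpoly t x)"

lemma walk_Node: "walk (Node M) x = - forest_walk M (- 1 - x) / (1 + forest_walk M (- 1 - x))"
  by (simp add: forest_walk_def multiset.map_comp o_def)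

lemma cpoly_Node: "cpoly (Node M) x = (-1) ^ leaves (Node M) * forest_cpoly M (- 1 - x) * (1 + forest_walk M (- 1 - x))"
  by (simp add: forest_walk_def forest_cpoly_def multiset.map_comp o_def)

declare walk.simps(2) [simp del] cpoly.simps(2) [simp del]

lemma forest_walk_simps [simp]: "forest_walk {#} x = 0" "forest_walk (add_mset t M) x
  = walk t x + forest_walk M x"
  and forest_cpoly_simps [simp]: "forest_cpoly {#} x = 1" "forest_cpoly (add_mset t M) x
    = cpoly t x * forest_cpoly M x"
  by (simp_all add: forest_walk_def forest_cpoly_def)

lemma forest_limb_spectral_data:
  "forest M V E \<Longrightarrow> \<exists>vs. distinct vs \<and> set vs = V \<and> spectral_data E vs (forest_cpoly M) (forest_walk M)"
  "limb t V E \<Longrightarrow> \<exists>vs. distinct vs \<and> set vs = V \<and> spectral_data E vs (cpoly t) (walk t)"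
proof (induction rule: forest_limb.inducts)
  case forest_empty
  have g: "spectral_data {} [] (forest_cpoly {#}) (forest_walk {#})"
    by (simp add: spectral_data_def shifted_mat_def det_def)
  show ?case by (rule exI[of _ "[]"], intro conjI g) simp_all
next
  case (forest_add M V1 E1 t V2 E2)
  then obtain vs1 vs2 where vs: "distinct vs1" "set vs1 = V1"
    "spectral_data E1 vs1 (forest_cpoly M) (forest_walk M)"
    "distinct vs2" "set vs2 = V2" "spectral_data E2 vs2 (cpoly t) (walk t)" by blast
  have "spectral_data (E1 \<union> E2) (vs1 @ vs2) (\<lambda>x. forest_cpoly M x * cpoly t x) (\<lambda>x. forest_walk M x + walk t x)"
  proof (rule spectral_data_append[OF vs(3,6)])
    show "e \<subseteq> set vs1" if "e \<in> E1" for e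
      using that vs(2) forest_wf[OF forest_add(1)] by (auto simp: all_edges_def)
    show "e \<subseteq> set vs2" if "e \<in> E2" for e
      using that vs(5) limb_wf[OF forest_add(2)] by (auto simp: all_edges_def)
    show "set vs1 \<inter> set vs2 = {}" using vs forest_add(3) by simp
  qed
  also have "(\<lambda>x. forest_cpoly M x * cpoly t x) = forest_cpoly (add_mset t M)" by (simp add: fun_eq_iff)
  also have "(\<lambda>x. forest_walk M x + walk t x) = forest_walk (add_mset t M)" by (simp add: fun_eq_iff)
  finally show ?case using vs forest_add(3) by (intro exI[of _ "vs1 @ vs2"]) simp
next
  case (limb_Leaf v)
  then show ?case using spectral_data_single[of v] by (intro exI[of _ "[v]"]) simp
next
  case (limb_Node M V E)
  then obtain vs where vs: "distinct vs" "set vs = V"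
    "spectral_data E vs (forest_cpoly M) (forest_walk M)" by blast
  have "length vs = leaves (Node M)"
    using forest_wf[OF limb_Node(1)] vs distinct_card by metis
  moreover have "spectral_data (all_edges (set vs) - E) vs (\<lambda>x. (-1) ^ length vs * forest_cpoly M (- 1 - x) * (1 + forest_walk M (- 1 - x)))
    (\<lambda>x. - forest_walk M (- 1 - x) / (1 + forest_walk M (- 1 - x)))"
    using vs forest_wf[OF limb_Node(1)] by (intro spectral_data_compl) auto
  ultimately show ?case using vs
    by (intro exI[of _ vs]) (simp add: walk_Node[abs_def] cpoly_Node[abs_def] del: leaves.simps)
qed

text \<open>Up to finitely many points this is the characteristic polynomial of a realising graph.
  It permits cancelling \<open>cpoly\<close> and shows that the denominator of \<open>walk\<close>
  at a node does not vanish.\<close>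

lemma cpoly_nonzero:
  assumes "t \<in> cotrees {}" shows "\<forall>\<^sub>F x in cofinite. cpoly t x \<noteq> 0"
proof -
  obtain E where E: "limb t {..<leaves t} E" using limb_exists[OF assms, of "{..<leaves t}"] by auto
  obtain vs where "spectral_data E vs (cpoly t) (walk t)" using forest_limb_spectral_data(2)[OF E] by blast
  then have "\<forall>\<^sub>F x in cofinite. \<forall>t'. det (shifted_mat E vs x t') = cpoly t x * (1 - t' * walk t x)"
    by (simp add: spectral_data_def)
  with eventually_det_nonzero[of E vs] show ?thesis
    by eventually_elim (metis mult_zero_left)
qed

text \<open>Recording \<open>cpoly\<close> and \<open>cpoly * walk\<close> instead of \<open>walk\<close> avoids rational functions.\<close>

definition has_polys :: "cotree \<Rightarrow> complex poly \<Rightarrow> complex poly \<Rightarrow> bool" where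
  "has_polys t p q \<longleftrightarrow> t \<in> cotrees {} \<and> (\<forall>\<^sub>F x in cofinite. cpoly t x = poly p x \<and> cpoly t x * walk t x
    = poly q x)"

definition forest_has_polys :: "cotree multiset \<Rightarrow> complex poly \<Rightarrow> complex poly \<Rightarrow> bool" where
  "forest_has_polys M p q \<longleftrightarrow> M \<in> cforests {} \<and> (\<forall>\<^sub>F x in cofinite. forest_cpoly M x = poly p x
    \<and> forest_cpoly M x * forest_walk M x = poly q x)"

lemma has_polys_Leaf: "has_polys Leaf [:0, 1:] 1"
proof -
  have "\<forall>\<^sub>F x :: complex in cofinite. x \<noteq> 0" by (simp add: eventually_cofinite)
  then show ?thesis unfolding has_polys_def by (auto intro: cotrees.Leaf elim!: eventually_mono)
qed

lemma forest_has_polys_empty: "forest_has_polys {#} 1 0"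
  by (simp add: forest_has_polys_def cforests_def)

lemma forest_has_polys_add:
  assumes "has_polys t p q" "forest_has_polys M p' q'"
  shows "forest_has_polys (add_mset t M) (p * p') (p * q' + q * p')"
proof -
  have "\<forall>\<^sub>F x in cofinite. cpoly t x = poly p x \<and> cpoly t x * walk t x = poly q x"
    "\<forall>\<^sub>F x in cofinite. forest_cpoly M x = poly p' x \<and> forest_cpoly M x * forest_walk M x = poly q' x"
    using assms by (auto simp: has_polys_def forest_has_polys_def)
  then have "\<forall>\<^sub>F x in cofinite. forest_cpoly (add_mset t M) x = poly p x * poly p' x \<and>
      forest_cpoly (add_mset t M) x * forest_walk (add_mset t M) x
        = poly p x * poly q' x + poly q x * poly p' x"
  proof eventually_elim
    case (elim x)
    have "forest_cpoly (add_mset t M) x * forest_walk (add_mset t M) x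
        = cpoly t x * (forest_cpoly M x * forest_walk M x) + (cpoly t x * walk t x) * forest_cpoly M x"
      by (simp add: algebra_simps)
    also have "\<dots> = poly p x * poly q' x + poly q x * poly p' x"
      by (intro arg_cong2[where f = "(+)"] arg_cong2[where f = "(*)"]) (use elim in blast)+
    finally show ?case using elim by simp
  qed
  then show ?thesis using assms by (auto simp: forest_has_polys_def has_polys_def cforests_def)
qed

text \<open>In the product of \<open>cpoly\<close> and \<open>walk\<close> the factor 1 + b cancels,
  leaving polynomials. Composition with \<open>[:-1, -1:]\<close> substitutes -1 - x. The results
  are separate variables so that explicit coefficient lists can be supplied and checked by
  computation.\<close>

lemma has_polys_Node:
  assumes M: "forest_has_polys M p q" and n: "2 \<le> size M" "(-1) ^ leaves (Node M) = s"
    and pq: "p' = Polynomial.smult s (pcompose (p + q) [:-1, -1:])" "q'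
      = Polynomial.smult (- s) (pcompose q [:-1, -1:])"
  shows "has_polys (Node M) p' q'"
proof -
  have t: "Node M \<in> cotrees {}" using M n by (auto simp: forest_has_polys_def cforests_def intro: cotrees.Node)
  have "\<forall>\<^sub>F x in cofinite. forest_cpoly M (- 1 - x) = poly p (- 1 - x)
    \<and> forest_cpoly M (- 1 - x) * forest_walk M (- 1 - x) = poly q (- 1 - x)"
    using M unfolding forest_has_polys_def by (intro eventually_reflect) auto
  with cpoly_nonzero[OF t] have "\<forall>\<^sub>F x in cofinite. cpoly (Node M) x = poly p' x
    \<and> cpoly (Node M) x * walk (Node M) x = poly q' x"
  proof eventually_elim
    case (elim x)
    define a b where "a = forest_cpoly M (- 1 - x)" and "b = forest_walk M (- 1 - x)"
    have c: "cpoly (Node M) x = s * a * (1 + b)" and w: "walk (Node M) x = - b / (1 + b)"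
      using cpoly_Node[of M x] walk_Node[of M x] n(2) by (auto simp: a_def b_def)
    have "1 + b \<noteq> 0" using elim(1) c by auto
    moreover have ab: "a = poly p (- 1 - x)" "a * b = poly q (- 1 - x)" using elim(2)
      by (auto simp: a_def b_def)
    ultimately have "cpoly (Node M) x * walk (Node M) x = - s * (a * b)"
      unfolding c w by (simp add: field_simps)
    moreover have "cpoly (Node M) x = s * (a + a * b)" unfolding c by (simp add: algebra_simps)
    ultimately show ?case using ab by (simp add: pq poly_pcompose)
  qed
  then show ?thesis using t by (simp add: has_polys_def)
qed

section \<open>A cospectral pair of limbs\<close>

text \<open>\<open>limbA\<close> and \<open>limbB\<close> were found by an exhaustive computer search; no pair with fewer leaves exists.\<close>

abbreviation "tK2 \<equiv> Node {#Leaf, Leaf#}"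
abbreviation "tK3 \<equiv> Node {#Leaf, Leaf, Leaf#}"
abbreviation "tA \<equiv> Node {#tK2, tK2#}"
abbreviation "tB \<equiv> Node {#tA, Leaf, Leaf, Leaf#}"
abbreviation "tC \<equiv> Node {#tB, tK3#}"
abbreviation "tD \<equiv> Node {#tC, Leaf#}"
abbreviation "tE \<equiv> Node {#tK2, Leaf, Leaf#}"
abbreviation "limbA \<equiv> Node {#tD, tE#}"
abbreviation "tP \<equiv> Node {#tK2, Leaf, Leaf, Leaf#}"
abbreviation "tQ \<equiv> Node {#tP, tK3#}"
abbreviation "tR \<equiv> Node {#tQ, Leaf, Leaf#}"
abbreviation "tS \<equiv> Node {#tA, Leaf#}"
abbreviation "limbB \<equiv> Node {#tR, tS#}"

text \<open>Coefficients ascend from the constant term: x^2 - 1 is the characteristic polynomial of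
  an edge, and (2 + 2 x) / (x^2 - 1) = 2 / (x - 1) its walk function. The sign \<open>s\<close> is
  the parity of the number of leaves.\<close>

lemma has_polys_tK2: "has_polys tK2 [:-1, 0, 1:]
  [:2, 2:]"
  by (rule has_polys_Node[OF forest_has_polys_add[OF has_polys_Leaf
    forest_has_polys_add[OF has_polys_Leaf
    forest_has_polys_empty]], where s = "1"])
    (simp_all add: pcompose_pCons)

lemma has_polys_tK3: "has_polys tK3 [:-2, -3, 0, 1:]
  [:3, 6, 3:]"
  by (rule has_polys_Node[OF forest_has_polys_add[OF has_polys_Leaf
    forest_has_polys_add[OF has_polys_Leaf
    forest_has_polys_add[OF has_polys_Leaf
    forest_has_polys_empty]]], where s = "-1"])
    (simp_all add: pcompose_pCons)

lemma has_polys_tA: "has_polys tA [:0, 0, -4, 0, 1:]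
  [:0, 0, 8, 4:]"
  by (rule has_polys_Node[OF forest_has_polys_add[OF has_polys_tK2
    forest_has_polys_add[OF has_polys_tK2
    forest_has_polys_empty]], where s = "1"])
    (simp_all add: pcompose_pCons)

lemma has_polys_tB: "has_polys tB [:10, 33, 28, -17, -38, -17, 0, 1:]
  [:-13, -46, -47, 12, 53, 34, 7:]"
  by (rule has_polys_Node[OF forest_has_polys_add[OF has_polys_tA
    forest_has_polys_add[OF has_polys_Leaf
    forest_has_polys_add[OF has_polys_Leaf
    forest_has_polys_add[OF has_polys_Leaf
    forest_has_polys_empty]]]], where s = "-1"])
    (simp_all add: pcompose_pCons)

lemma has_polys_tC: "has_polys tC [:0, 0, 0, 0, 0, 0, 36, -24, -25, 0, 1:]
  [:0, 0, 0, 0, 0, 0, -72, 24, 50, 10:]"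
  by (rule has_polys_Node[OF forest_has_polys_add[OF has_polys_tB
    forest_has_polys_add[OF has_polys_tK3
    forest_has_polys_empty]], where s = "1"])
    (simp_all add: pcompose_pCons)

lemma has_polys_tD: "has_polys tD [:-56, -310, -640, -475, 280, 764, 496, 50, -80, -30, 0, 1:]
  [:92, 540, 1223, 1144, -160, -1352, -1210, -392, 44, 60, 11:]"
  by (rule has_polys_Node[OF forest_has_polys_add[OF has_polys_tC
    forest_has_polys_add[OF has_polys_Leaf
    forest_has_polys_empty]], where s = "-1"])
    (simp_all add: pcompose_pCons)

lemma has_polys_tE: "has_polys tE [:0, -4, -5, 0, 1:]
  [:0, 6, 10, 4:]"
  by (rule has_polys_Node[OF forest_has_polys_add[OF has_polys_tK2
    forest_has_polys_add[OF has_polys_Leaf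
    forest_has_polys_add[OF has_polys_Leaf
    forest_has_polys_empty]]], where s = "1"])
    (simp_all add: pcompose_pCons)

lemma has_polys_limbA: "has_polys limbA [:0, 0, 0, 0, 0, 0, 0, 72, -264, 10, 510, -13, -246, -70, 0, 1:]
  [:0, 0, 0, 0, 0, 0, 0, -144, 420, 124, -789, -144, 330, 140, 15:]"
  by (rule has_polys_Node[OF forest_has_polys_add[OF has_polys_tD
    forest_has_polys_add[OF has_polys_tE
    forest_has_polys_empty]], where s = "-1"])
    (simp_all add: pcompose_pCons)

lemma has_polys_tP: "has_polys tP [:0, -6, -14, -9, 0, 1:]
  [:0, 8, 21, 18, 5:]"
  by (rule has_polys_Node[OF forest_has_polys_add[OF has_polys_tK2
    forest_has_polys_add[OF has_polys_Leaf
    forest_has_polys_add[OF has_polys_Leaf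
    forest_has_polys_add[OF has_polys_Leaf
    forest_has_polys_empty]]]], where s = "-1"])
    (simp_all add: pcompose_pCons)

lemma has_polys_tQ: "has_polys tQ [:0, 0, 0, 0, 9, -6, -16, 0, 1:]
  [:0, 0, 0, 0, -18, 6, 32, 8:]"
  by (rule has_polys_Node[OF forest_has_polys_add[OF has_polys_tP
    forest_has_polys_add[OF has_polys_tK3
    forest_has_polys_empty]], where s = "1"])
    (simp_all add: pcompose_pCons)

lemma has_polys_tR: "has_polys tR [:0, 56, 310, 696, 785, 416, 21, -80, -29, 0, 1:]
  [:0, -78, -452, -1082, -1350, -880, -208, 78, 58, 10:]"
  by (rule has_polys_Node[OF forest_has_polys_add[OF has_polys_tQ
    forest_has_polys_add[OF has_polys_Leaf
    forest_has_polys_add[OF has_polys_Leaf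
    forest_has_polys_empty]]], where s = "1"])
    (simp_all add: pcompose_pCons)

lemma has_polys_tS: "has_polys tS [:4, 5, -4, -6, 0, 1:]
  [:-7, -12, 2, 12, 5:]"
  by (rule has_polys_Node[OF forest_has_polys_add[OF has_polys_tA
    forest_has_polys_add[OF has_polys_Leaf
    forest_has_polys_empty]], where s = "-1"])
    (simp_all add: pcompose_pCons)

text \<open>Both coefficient lists coincide with those of \<open>limbA\<close>.\<close>

lemma has_polys_limbB: "has_polys limbB [:0, 0, 0, 0, 0, 0, 0, 72, -264, 10, 510, -13, -246, -70, 0, 1:]
  [:0, 0, 0, 0, 0, 0, 0, -144, 420, 124, -789, -144, 330, 140, 15:]"
  by (rule has_polys_Node[OF forest_has_polys_add[OF has_polys_tR
    forest_has_polys_add[OF has_polys_tS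
    forest_has_polys_empty]], where s = "-1"])
    (simp_all add: pcompose_pCons)

section \<open>Exchanging a limb\<close>

text \<open>Equality of the pair \<open>cpoly\<close>, \<open>walk\<close> is demanded because the
  pair, unlike \<open>cpoly\<close> alone, passes through a complemented disjoint union.\<close>

definition cospectral_limb :: "cotree \<Rightarrow> cotree \<Rightarrow> bool" where
  "cospectral_limb t t' \<longleftrightarrow> t' \<in> cotrees {} \<and> t' \<noteq> t \<and> leaves t' = leaves t \<and>
    (\<forall>\<^sub>F x in cofinite. cpoly t' x = cpoly t x \<and> walk t' x = walk t x)"

lemma cospectral_limb_limbA: "cospectral_limb limbA limbB"
proof -
  have "limbB \<in> cotrees {}" using has_polys_limbB by (simp add: has_polys_def)
  moreover have "limbB \<noteq> limbA" by (auto simp: add_eq_conv_ex)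
  moreover have "leaves limbB = leaves limbA" by simp
  moreover have "\<forall>\<^sub>F x in cofinite. cpoly limbB x = cpoly limbA x \<and> walk limbB x = walk limbA x"
    using conjunct2[OF has_polys_limbA[unfolded has_polys_def]] conjunct2[OF has_polys_limbB[unfolded has_polys_def]]
      cpoly_nonzero[OF conjunct1[OF has_polys_limbA[unfolded has_polys_def]]]
    by eventually_elim (metis mult_left_cancel)
  ultimately show ?thesis unfolding cospectral_limb_def by blast
qed

lemma cospectral_limb_forest:
  assumes "s \<in># M" "M \<in> cforests {}" "cospectral_limb s s'"
  obtains M' where "M' \<in> cforests {}" "M' \<noteq> M" "leaves (Node M') = leaves (Node M)" "size M' = size M"
    "\<forall>\<^sub>F x in cofinite. forest_cpoly M' x = forest_cpoly M x \<and> forest_walk M' x = forest_walk M x"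
proof -
  obtain N where N: "M = add_mset s N" using multi_member_split[OF assms(1)] by blast
  have "\<forall>\<^sub>F x in cofinite. forest_cpoly (add_mset s' N) x = forest_cpoly M x
    \<and> forest_walk (add_mset s' N) x = forest_walk M x"
    using assms(3) N by (auto simp: cospectral_limb_def elim: eventually_mono)
  then show ?thesis using assms N by (intro that[of "add_mset s' N"]) (auto simp: cospectral_limb_def cforests_def)
qed

text \<open>A cotree that does not avoid \<open>limbA\<close> either equals it or has a child that
  does not avoid it. Replacing that child preserves the values at -1 - x and so those at the
  root.\<close>

lemma cospectral_limb_exists:
  assumes "t \<in> cotrees {}" "t \<notin> cotrees {limbA}"
  shows "\<exists>t'. cospectral_limb t t'"
  using assms
proof induction
  case Leaf
  then show ?case by (simp add: cotrees.Leaf)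
next
  case (Node M)
  show ?case
  proof (cases "Node M = limbA")
    case True
    then show ?thesis using cospectral_limb_limbA by metis
  next
    case False
    then have "\<exists>s. s \<in># M \<and> s \<notin> cotrees {limbA}" using Node cotrees.Node[of M "{limbA}"] by auto
    then obtain s s' where s: "s \<in># M" "cospectral_limb s s'" using Node by blast
    have M: "M \<in> cforests {}" using Node by (auto simp: cforests_def)
    obtain M' where M': "M' \<in> cforests {}" "M' \<noteq> M" "leaves (Node M') = leaves (Node M)" "size M' = size M"
      "\<forall>\<^sub>F x in cofinite. forest_cpoly M' x = forest_cpoly M x \<and> forest_walk M' x = forest_walk M x"
      using cospectral_limb_forest[OF s(1) M s(2)] by blast
    have "\<forall>\<^sub>F x in cofinite. cpoly (Node M') x = cpoly (Node M) x \<and> walk (Node M') x = walk (Node M) x"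
      using eventually_reflect[OF M'(5)]
      by eventually_elim (simp add: cpoly_Node walk_Node M'(3) del: leaves.simps)
    moreover have "Node M' \<in> cotrees {}" using M' Node.hyps by (auto simp: cforests_def intro: cotrees.Node)
    ultimately have "cospectral_limb (Node M) (Node M')" using M' unfolding cospectral_limb_def by simp
    then show ?thesis by blast
  qed
qed

lemma eventually_cofinite_poly_eq:
  fixes p q :: "complex poly"
  assumes "\<forall>\<^sub>F x in cofinite. poly p x = poly q x"
  shows "p = q"
proof (rule ccontr)
  assume "p \<noteq> q"
  then have "finite {x. poly (p - q) x = 0}" by (intro poly_roots_finite) auto
  moreover have "finite {x. poly (p - q) x \<noteq> 0}" using assms by (simp add: eventually_cofinite)
  ultimately have "finite ({x. poly (p - q) x = 0} \<union> {x. poly (p - q) x \<noteq> 0})" by blast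
  also have "{x. poly (p - q) x = 0} \<union> {x. poly (p - q) x \<noteq> 0} = UNIV" by blast
  finally show False using infinite_UNIV_char_0 by blast
qed

lemma poly_char_poly_adj_matrix:
  assumes "distinct vs" "set vs = {0..<n}"
  shows "poly (char_poly (adj_matrix n E)) x = det (shifted_mat E vs x 0)"
proof -
  have "adj_matrix n E = mat (length [0..<n]) (length [0..<n]) (\<lambda>(i, j). adj E ([0..<n] ! i) ([0..<n] ! j))"
    by (rule eq_matI) (auto simp: adj_matrix_def adj_def)
  then have "poly (char_poly (adj_matrix n E)) x = det (shifted_mat E [0..<n] x 0)"
    by (simp only: poly_char_poly_shifted_mat)
  also have "mset vs = mset [0..<n]" using assms by (subst set_eq_iff_mset_eq_distinct[symmetric]) auto
  then have "det (shifted_mat E [0..<n] x 0) = det (shifted_mat E vs x 0)"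
    by (intro det_shifted_mat_permute) simp
  finally show ?thesis .
qed

lemma forest_graphs: "forest M {0..<n} E \<Longrightarrow> E \<in> graphs n"
  using forest_wf by (auto simp: graphs_def)

lemma graph_iso_forest:
  assumes "forest M {0..<n} E" "E' \<in> graphs n"
  shows "graph_iso n E E' \<longleftrightarrow> forest M {0..<n} E'"
proof
  assume "graph_iso n E E'"
  then obtain f where "bij_betw f {0..<n} {0..<n}" "E' = (`) f ` E" by (auto simp: graph_iso_def)
  then show "forest M {0..<n} E'"
    using forest_limb_image(1)[OF assms(1), of f] by (auto simp: bij_betw_def)
next
  assume "forest M {0..<n} E'"
  then show "graph_iso n E E'" unfolding graph_iso_def using forest_limb_iso(1)[OF assms(1)] by blast
qed

lemma has_cospectral_mate_if_not_avoiding: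
  assumes E: "forest M {0..<n} E" and M: "M \<notin> cforests {limbA}"
  shows "has_cospectral_mate n E"
proof -
  have M0: "M \<in> cforests {}" "n = leaves (Node M)" using forest_wf[OF E] by auto
  then obtain s where s: "s \<in># M" "s \<in> cotrees {}" "s \<notin> cotrees {limbA}" using M by (auto simp: cforests_def)
  obtain s' where "cospectral_limb s s'" using cospectral_limb_exists[OF s(2,3)] by blast
  then obtain M' where M': "M' \<in> cforests {}" "M' \<noteq> M" "leaves (Node M') = leaves (Node M)"
      "\<forall>\<^sub>F x in cofinite. forest_cpoly M' x = forest_cpoly M x \<and> forest_walk M' x = forest_walk M x"
    using cospectral_limb_forest[OF s(1) M0(1)] by blast
  obtain H where H: "forest M' {0..<n} H" using forest_exists[OF M'(1), of "{0..<n}"] M0(2) M'(3) by auto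
  obtain vs where vs: "distinct vs" "set vs = {0..<n}" "spectral_data E vs (forest_cpoly M) (forest_walk M)"
    using forest_limb_spectral_data(1)[OF E] by blast
  obtain us where us: "distinct us" "set us = {0..<n}" "spectral_data H us (forest_cpoly M') (forest_walk M')"
    using forest_limb_spectral_data(1)[OF H] by blast
  have "\<forall>\<^sub>F x in cofinite. poly (char_poly (adj_matrix n H)) x = poly (char_poly (adj_matrix n E)) x"
    using vs(3) us(3) M'(4) 
    unfolding spectral_data_def poly_char_poly_adj_matrix[OF vs(1,2), of E] poly_char_poly_adj_matrix[OF us(1,2), of H]
    by eventually_elim simp
  \<comment> \<open>The spectral data at t = 0 compare both characteristic polynomials at all but
    finitely many points, which determines them.\<close>
  then have "char_poly (adj_matrix n H) = char_poly (adj_matrix n E)" by (rule eventually_cofinite_poly_eq)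
  moreover have "\<not> graph_iso n E H"
    using graph_iso_forest[OF E forest_graphs[OF H]] forest_limb_unique(1)[OF H] M'(2) by blast
  ultimately show ?thesis
    unfolding has_cospectral_mate_def Spec_def using forest_graphs[OF H] by auto
qed

section \<open>Counting isomorphism classes\<close>

definition forest_class :: "nat \<Rightarrow> cotree multiset \<Rightarrow> nat set set set" where
  "forest_class n M = {E. forest M {0..<n} E}"

lemma iso_class_forest:
  assumes "forest M {0..<n} E" shows "iso_class n E = forest_class n M"
proof -
  have "E' \<in> graphs n \<and> graph_iso n E E' \<longleftrightarrow> forest M {0..<n} E'" for E'
    using graph_iso_forest[OF assms, of E'] forest_graphs[of M n E'] by blast
  then show ?thesis by (simp add: iso_class_def forest_class_def)
qed

lemma cforests_realised: "M \<in> cforests_of_size {} n \<Longrightarrow> \<exists>E. forest M {0..<n} E"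
  using forest_exists[of M "{0..<n}"] by (simp add: cforests_of_size_def del: leaves.simps)

lemma inj_on_forest_class: "inj_on (forest_class n) (cforests_of_size {} n)"
proof (rule inj_onI)
  fix M N assume *: "M \<in> cforests_of_size {} n" "N \<in> cforests_of_size {} n" "forest_class n M
    = forest_class n N"
  obtain E where "forest M {0..<n} E" using cforests_realised *(1) by blast
  moreover from this have "forest N {0..<n} E" using *(3) by (auto simp: forest_class_def)
  ultimately show "M = N" using forest_limb_unique(1) by blast
qed

text \<open>Multisets of cotrees serve as canonical names of the isomorphism classes. The case n = 0
  differs: the empty forest has no leaves, but the empty graph is no cograph.\<close>

lemma cograph_classes:
  assumes "n \<ge> 1"
  shows "{iso_class n E | E. E \<in> graphs n \<and> cograph {0..<n} E} = forest_class n ` cforests_of_size {} n"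
proof (intro equalityI subsetI)
  fix c assume "c \<in> {iso_class n E | E. E \<in> graphs n \<and> cograph {0..<n} E}"
  then obtain E where E: "c = iso_class n E" "cograph {0..<n} E" by blast
  then obtain M where M: "forest M {0..<n} E" using cograph_forest by blast
  then have "M \<in> cforests_of_size {} n" using forest_wf[OF M] by (simp add: cforests_of_size_def)
  then show "c \<in> forest_class n ` cforests_of_size {} n" using iso_class_forest[OF M] E by blast
next
  fix c assume "c \<in> forest_class n ` cforests_of_size {} n"
  then obtain M where M: "M \<in> cforests_of_size {} n" "c = forest_class n M" by blast
  then obtain E where E: "forest M {0..<n} E" using cforests_realised by blast
  have "M \<noteq> {#}" using M assms by (auto simp: cforests_of_size_def)
  then show "c \<in> {iso_class n E | E. E \<in> graphs n \<and> cograph {0..<n} E}"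
    using iso_class_forest[OF E] forest_cograph(1)[OF E] forest_graphs[OF E] M by blast
qed

lemma cograph_count_eq: "n \<ge> 1 \<Longrightarrow> cograph_count n = card (cforests_of_size {} n)"
  unfolding cograph_count_def by (simp only: cograph_classes card_image[OF inj_on_forest_class])

lemma cograph_mate_count_bounds:
  assumes "n \<ge> 1"
  shows "cograph_mate_count n \<le> card (cforests_of_size {} n)"
    and "card (cforests_of_size {} n) \<le> cograph_mate_count n + card (cforests_of_size {limbA} n)"
proof -
  let ?D = "{iso_class n E | E. E \<in> graphs n \<and> cograph {0..<n} E \<and> has_cospectral_mate n E}"
  have sub: "?D \<subseteq> forest_class n ` cforests_of_size {} n" unfolding cograph_classes[OF assms, symmetric] by blast
  then have fin: "finite ?D" by (rule finite_subset) (intro finite_imageI finite_cforests_of_size)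
  have "card ?D \<le> card (forest_class n ` cforests_of_size {} n)" using sub finite_cforests_of_size
    by (intro card_mono) auto
  then show "cograph_mate_count n \<le> card (cforests_of_size {} n)"
    unfolding cograph_mate_count_def by (simp only: card_image[OF inj_on_forest_class])
  have "forest_class n ` (cforests_of_size {} n - cforests_of_size {limbA} n) \<subseteq> ?D"
  proof
    fix c assume "c \<in> forest_class n ` (cforests_of_size {} n - cforests_of_size {limbA} n)"
    then obtain M where M: "M \<in> cforests_of_size {} n" "M \<notin> cforests {limbA}" "c = forest_class n M"
      by (auto simp: cforests_of_size_def)
    then obtain E where E: "forest M {0..<n} E" using cforests_realised by blast
    have "M \<noteq> {#}" using M assms by (auto simp: cforests_of_size_def)
    then show "c \<in> ?D"
      using iso_class_forest[OF E] forest_cograph(1)[OF E] forest_graphs[OF E] has_cospectral_mate_if_not_avoiding[OF E M(2)] M(3) by blast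
  qed
  then have "card (forest_class n ` (cforests_of_size {} n - cforests_of_size {limbA} n))
    \<le> cograph_mate_count n"
    unfolding cograph_mate_count_def using fin by (intro card_mono)
  also have "card (forest_class n ` (cforests_of_size {} n - cforests_of_size {limbA} n))
    = card (cforests_of_size {} n - cforests_of_size {limbA} n)"
    by (intro card_image inj_on_subset[OF inj_on_forest_class]) auto
  finally show "card (cforests_of_size {} n) \<le> cograph_mate_count n + card (cforests_of_size {limbA} n)"
    using diff_card_le_card_Diff[OF finite_cforests_of_size[of "{limbA}" n], of "cforests_of_size {} n"] by linarith
qed

theorem theorem1p1:
  shows "(\<lambda>n. real (cograph_mate_count n) / real (cograph_count n)) \<longlonglongrightarrow> 1"
proof -
  let ?f = "\<lambda>n. real (card (cforests_of_size {} n))" and ?b = "\<lambda>n. real (card (cforests_of_size {limbA} n))"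
  have "limbA \<in> cotrees {}" using has_polys_limbA by (simp add: has_polys_def)
  then have "(\<lambda>n. ?b n / ?f n) \<longlonglongrightarrow> 0" by (intro avoiding_forests_ratio) auto
  then have "(\<lambda>n. 1 - ?b n / ?f n) \<longlonglongrightarrow> 1 - 0" by (intro tendsto_intros)
  then have lim: "(\<lambda>n. 1 - ?b n / ?f n) \<longlonglongrightarrow> 1" by simp
  have pos: "0 < ?f n" if "n \<ge> 1" for n
    using card_cotrees_pos[OF that] card_cotrees_le_cforests[of n] by simp
  show ?thesis
  proof (rule tendsto_sandwich[OF _ _ lim tendsto_const])
    show "\<forall>\<^sub>F n in sequentially. 1 - ?b n / ?f n \<le> real (cograph_mate_count n) / real (cograph_count n)"
      using eventually_ge_at_top[of 1]
    proof eventually_elim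
      case (elim n)
      have "?f n - ?b n \<le> real (cograph_mate_count n)"
        using cograph_mate_count_bounds(2)[OF elim] by linarith
      then have "(?f n - ?b n) / ?f n \<le> real (cograph_mate_count n) / ?f n"
        by (intro divide_right_mono) auto
      then show ?case using pos[OF elim] cograph_count_eq[OF elim] by (simp add: diff_divide_distrib)
    qed
    show "\<forall>\<^sub>F n in sequentially. real (cograph_mate_count n) / real (cograph_count n) \<le> 1"
      using eventually_ge_at_top[of 1]
    proof eventually_elim
      case (elim n)
      then show ?case using cograph_mate_count_bounds(1)[OF elim] pos[OF elim] by (simp add: cograph_count_eq)
    qed
  qed
qed

end
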